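(* Let $(X,\rho_X)$ be a symmetric rack. Then the category $\mathbf{SRMod}_{(X,\rho_X)}$ of $(X,\rho_X)$-modules is equivalent to the category $\mathbf{Ab}(\mathbf{SR}|_{(X,\rho_X)})$ of abelian group objects in the slice category $\mathbf{SR}|_{(X,\rho_X)}$ of symmetric racks over $(X,\rho_X)$.
   Context: A rack is a set $X$ with a binary operation $*$ such that every map $x\mapsto x*y$ is a bijection of $X$ and $(x*y)*z=(x*z)*(y*z)$ for all $x,y,z\in X$. Write $x*^{-1}y$ for the unique $z$ with $z*y=x$. A symmetric rack $(X,\rho_X)$ is a rack $X$ with a map $\rho_X:X\to X$ (a good involution) such that $\rho_X^2=\mathrm{id}_X$, $\rho_X(x*y)=\rho_X(x)*y$ and $x*\rho_X(y)=x*^{-1}y$ for all $x,y\in X$. A homomorphism of symmetric racks $f:(X,\rho_X)\to(Y,\rho_Y)$ is a map with $f(x*y)=f(x)*f(y)$ and $f(\rho_X(x))=\rho_Y(f(x))$. $\mathbf{SR}$ is the category of symmetric racks and their homomorphisms. An $(X,\rho_X)$-module $\mathscr{F}=(A,\phi,\psi,\eta)$ over a symmetric rack $(X,\rho_X)$ consists of abelian groups $A_x$ ($x\in X$), group isomorphisms $\phi_{x,y}:A_x\to A_{x*y}$, and group homomorphisms $\psi_{x,y}:A_y\to A_{x*y}$ and $\eta_x:A_x\to A_{\rho_X(x)}$ ($x,y\in X$) such that for all $x,y,z\in X$, $a\in A_z$, $b\in A_y$: - $\phi_{x*y,z}\phi_{x,y}=\phi_{x*z,y*z}\phi_{x,z}$;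 - $\phi_{x*y,z}\psi_{x,y}=\psi_{x*z,y*z}\phi_{y,z}$; - $\eta_{\rho_X(x)}\eta_x=\mathrm{id}$; - $\eta_{x*y}\phi_{x,y}=\phi_{\rho_X(x),y}\eta_x$; - $\psi_{\rho_X(x),y}=\eta_{x*y}\psi_{x,y}$; - $\phi_{x*^{-1}y,y}\phi_{x,\rho_X(y)}=\mathrm{id}$; - $\psi_{x*y,z}(a)=\phi_{x*z,y*z}\psi_{x,z}(a)+\psi_{x*z,y*z}\psi_{y,z}(a)$; - $\phi_{x*^{-1}y,y}\psi_{x,\rho_X(y)}(\eta_y(b))=-\psi_{x*\rho_X(y),y}(b)$. A morphism ($(X,\rho_X)$-map) from $(A,\phi,\psi,\eta)$ to $(A',\phi',\psi',\eta')$ is a family of group homomorphisms $f_x:A_x\to A'_x$ ($x\in X$) with $\phi'_{x,y}f_x=f_{x*y}\phi_{x,y}$, $\psi'_{x,y}f_y=f_{x*y}\psi_{x,y}$ and $\eta'_xf_x=f_{\rho_X(x)}\eta_x$. These form the category $\mathbf{SRMod}_{(X,\rho_X)}$. The slice category $\mathbf{SR}|_{(X,\rho_X)}$ has as objects the symmetric rack homomorphisms $(Y,\rho_Y)\to(X,\rho_X)$ and as morphisms the symmetric rack homomorphisms commuting with the maps to $(X,\rho_X)$. The product of $f:Y\to X$ and $g:Z\to X$ in it is the pullback $Y\times_XZ=\{(y,z): f(y)=g(z)\}$ with componentwise operation and involution; the terminal object is $\mathrm{id}_X$. Abelian group objects are taken with respect to these finite products, and morphisms in $\mathbf{Ab}(\mathbf{SR}|_{(X,\rho_X)})$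 are the slice morphisms that commute with the multiplication maps. *)

theory Defs
  imports "HOL-Algebra.Group" "HOL-Library.FuncSet" "HOL-Library.Infinite_Typeclass"
begin

section \<open>Categories and equivalences of categories\<close>

text \<open>
  Hom-sets need not be disjoint, so composition and the arrow part of a functor take the
  objects involved as arguments: \<open>Comp C a b c g f\<close> is $g \circ f$ for $f : a \to b$ and
  $g : b \to c$.
\<close>

record ('o, 'm) category =
  Obj :: "'o set"
  Arr :: "'o \<Rightarrow> 'o \<Rightarrow> 'm set"
  Ident :: "'o \<Rightarrow> 'm"
  Comp :: "'o \<Rightarrow> 'o \<Rightarrow> 'o \<Rightarrow> 'm \<Rightarrow> 'm \<Rightarrow> 'm"

locale category =
  fixes C :: "('o, 'm) category"
  assumes Ident_Arr: "a \<in> Obj C \<Longrightarrow> Ident C a \<in> Arr C a a"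
    and Comp_Arr: "\<lbrakk>a \<in> Obj C; b \<in> Obj C; c \<in> Obj C; f \<in> Arr C a b; g \<in> Arr C b c\<rbrakk>
          \<Longrightarrow> Comp C a b c g f \<in> Arr C a c"
    and Comp_Ident_left: "\<lbrakk>a \<in> Obj C; b \<in> Obj C; f \<in> Arr C a b\<rbrakk>
          \<Longrightarrow> Comp C a b b (Ident C b) f = f"
    and Comp_Ident_right: "\<lbrakk>a \<in> Obj C; b \<in> Obj C; f \<in> Arr C a b\<rbrakk>
          \<Longrightarrow> Comp C a a b f (Ident C a) = f"
    and Comp_assoc: "\<lbrakk>a \<in> Obj C; b \<in> Obj C; c \<in> Obj C; d \<in> Obj C;
           f \<in> Arr C a b; g \<in> Arr C b c; h \<in> Arr C c d\<rbrakk>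
          \<Longrightarrow> Comp C a c d h (Comp C a b c g f) = Comp C a b d (Comp C b c d h g) f"

record ('o, 'm, 'p, 'n) cat_functor =
  fobj :: "'o \<Rightarrow> 'p"
  farr :: "'o \<Rightarrow> 'o \<Rightarrow> 'm \<Rightarrow> 'n"

locale cat_functor =
  fixes C :: "('o, 'm) category" and D :: "('p, 'n) category"
    and F :: "('o, 'm, 'p, 'n) cat_functor"
  assumes fobj_Obj: "a \<in> Obj C \<Longrightarrow> fobj F a \<in> Obj D"
    and farr_Arr: "\<lbrakk>a \<in> Obj C; b \<in> Obj C; f \<in> Arr C a b\<rbrakk>
          \<Longrightarrow> farr F a b f \<in> Arr D (fobj F a) (fobj F b)"
    and farr_Ident: "a \<in> Obj C \<Longrightarrow> farr F a a (Ident C a) = Ident D (fobj F a)"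
    and farr_Comp: "\<lbrakk>a \<in> Obj C; b \<in> Obj C; c \<in> Obj C; f \<in> Arr C a b; g \<in> Arr C b c\<rbrakk>
          \<Longrightarrow> farr F a c (Comp C a b c g f)
              = Comp D (fobj F a) (fobj F b) (fobj F c) (farr F b c g) (farr F a b f)"

definition id_functor :: "('o, 'm, 'o, 'm) cat_functor"
  where "id_functor = \<lparr>fobj = (\<lambda>a. a), farr = (\<lambda>a b f. f)\<rparr>"

definition comp_functor ::
  "('p, 'n, 'q, 'k) cat_functor \<Rightarrow> ('o, 'm, 'p, 'n) cat_functor \<Rightarrow> ('o, 'm, 'q, 'k) cat_functor"
  where "comp_functor G F =
    \<lparr>fobj = (\<lambda>a. fobj G (fobj F a)),
     farr = (\<lambda>a b f. farr G (fobj F a) (fobj F b) (farr F a b f))\<rparr>"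

definition isomorphism :: "('o, 'm) category \<Rightarrow> 'o \<Rightarrow> 'o \<Rightarrow> 'm \<Rightarrow> bool"
  where "isomorphism C a b f \<longleftrightarrow>
    f \<in> Arr C a b \<and> (\<exists>g \<in> Arr C b a. Comp C a b a g f = Ident C a \<and> Comp C b a b f g = Ident C b)"

definition natural_isomorphism ::
  "('o, 'm) category \<Rightarrow> ('p, 'n) category \<Rightarrow> ('o, 'm, 'p, 'n) cat_functor
    \<Rightarrow> ('o, 'm, 'p, 'n) cat_functor \<Rightarrow> ('o \<Rightarrow> 'n) \<Rightarrow> bool"
  where "natural_isomorphism C D F G t \<longleftrightarrow>
    (\<forall>a \<in> Obj C. isomorphism D (fobj F a) (fobj G a) (t a)) \<and>
    (\<forall>a \<in> Obj C. \<forall>b \<in> Obj C. \<forall>f \<in> Arr C a b.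
      Comp D (fobj F a) (fobj G a) (fobj G b) (farr G a b f) (t a)
      = Comp D (fobj F a) (fobj F b) (fobj G b) (t b) (farr F a b f))"

definition equivalent_categories :: "('o, 'm) category \<Rightarrow> ('p, 'n) category \<Rightarrow> bool"
  where "equivalent_categories C D \<longleftrightarrow>
    category C \<and> category D \<and>
    (\<exists>F G \<eta> \<epsilon>. cat_functor C D F \<and> cat_functor D C G
       \<and> natural_isomorphism C C id_functor (comp_functor G F) \<eta>
       \<and> natural_isomorphism D D (comp_functor F G) id_functor \<epsilon>)"


section \<open>Symmetric racks\<close>

record 'a rack = "'a partial_object" +
  rop :: "'a \<Rightarrow> 'a \<Rightarrow> 'a" (infixl \<open>\<triangleright>\<index>\<close> 70)

record 'a symm_rack = "'a rack" +
  ginv :: "'a \<Rightarrow> 'a" (\<open>\<rho>\<index>\<close>)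

locale rack =
  fixes X (structure)
  assumes rop_closed: "\<lbrakk>x \<in> carrier X; y \<in> carrier X\<rbrakk> \<Longrightarrow> x \<triangleright> y \<in> carrier X"
    and rop_bij: "y \<in> carrier X \<Longrightarrow> bij_betw (\<lambda>x. x \<triangleright> y) (carrier X) (carrier X)"
    and rop_distrib: "\<lbrakk>x \<in> carrier X; y \<in> carrier X; z \<in> carrier X\<rbrakk>
          \<Longrightarrow> (x \<triangleright> y) \<triangleright> z = (x \<triangleright> z) \<triangleright> (y \<triangleright> z)"

definition rop_inv :: "('a, 'b) rack_scheme \<Rightarrow> 'a \<Rightarrow> 'a \<Rightarrow> 'a" (infixl \<open>\<triangleleft>\<index>\<close> 70)
  where "x \<triangleleft>\<^bsub>X\<^esub> y = (THE z. z \<in> carrier X \<and> z \<triangleright>\<^bsub>X\<^esub> y = x)"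

locale symmetric_rack = rack +
  assumes ginv_closed: "x \<in> carrier X \<Longrightarrow> \<rho> x \<in> carrier X"
    and ginv_ginv: "x \<in> carrier X \<Longrightarrow> \<rho> (\<rho> x) = x"
    and ginv_rop: "\<lbrakk>x \<in> carrier X; y \<in> carrier X\<rbrakk> \<Longrightarrow> \<rho> (x \<triangleright> y) = \<rho> x \<triangleright> y"
    and rop_ginv: "\<lbrakk>x \<in> carrier X; y \<in> carrier X\<rbrakk> \<Longrightarrow> x \<triangleright> \<rho> y = x \<triangleleft> y"

text \<open>
  Morphisms are extensional functions (undefined outside the carrier), so that HOL equality is
  equality of maps and \<^const>\<open>compose\<close> is composition.
\<close>

definition sr_hom :: "'a symm_rack \<Rightarrow> 'b symm_rack \<Rightarrow> ('a \<Rightarrow> 'b) set"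
  where "sr_hom X Y =
    {f \<in> carrier X \<rightarrow>\<^sub>E carrier Y.
      (\<forall>x \<in> carrier X. \<forall>y \<in> carrier X. f (x \<triangleright>\<^bsub>X\<^esub> y) = f x \<triangleright>\<^bsub>Y\<^esub> f y) \<and>
      (\<forall>x \<in> carrier X. f (\<rho>\<^bsub>X\<^esub> x) = \<rho>\<^bsub>Y\<^esub> (f x))}"


section \<open>Modules over a symmetric rack\<close>

text \<open>The abelian groups are written multiplicatively, as usual for \<^const>\<open>comm_group\<close>.\<close>

record ('x, 'a) sr_module =
  mgrp :: "'x \<Rightarrow> 'a monoid"
  mphi :: "'x \<Rightarrow> 'x \<Rightarrow> 'a \<Rightarrow> 'a"
  mpsi :: "'x \<Rightarrow> 'x \<Rightarrow> 'a \<Rightarrow> 'a"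
  meta :: "'x \<Rightarrow> 'a \<Rightarrow> 'a"

locale sr_module =
  fixes X :: "'x symm_rack" (structure) and M :: "('x, 'a) sr_module"
  fixes A \<phi> \<psi> \<eta>
  defines "A \<equiv> mgrp M" and "\<phi> \<equiv> mphi M" and "\<psi> \<equiv> mpsi M" and "\<eta> \<equiv> meta M"
  assumes grp: "x \<in> carrier X \<Longrightarrow> comm_group (A x)"
    and phi_iso: "\<lbrakk>x \<in> carrier X; y \<in> carrier X\<rbrakk> \<Longrightarrow> \<phi> x y \<in> iso (A x) (A (x \<triangleright> y))"
    and psi_hom: "\<lbrakk>x \<in> carrier X; y \<in> carrier X\<rbrakk> \<Longrightarrow> \<psi> x y \<in> hom (A y) (A (x \<triangleright> y))"
    and eta_hom: "x \<in> carrier X \<Longrightarrow> \<eta> x \<in> hom (A x) (A (\<rho> x))"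
    and phi_phi: "\<lbrakk>x \<in> carrier X; y \<in> carrier X; z \<in> carrier X; a \<in> carrier (A x)\<rbrakk>
          \<Longrightarrow> \<phi> (x \<triangleright> y) z (\<phi> x y a) = \<phi> (x \<triangleright> z) (y \<triangleright> z) (\<phi> x z a)"
    and phi_psi: "\<lbrakk>x \<in> carrier X; y \<in> carrier X; z \<in> carrier X; b \<in> carrier (A y)\<rbrakk>
          \<Longrightarrow> \<phi> (x \<triangleright> y) z (\<psi> x y b) = \<psi> (x \<triangleright> z) (y \<triangleright> z) (\<phi> y z b)"
    and eta_eta: "\<lbrakk>x \<in> carrier X; a \<in> carrier (A x)\<rbrakk> \<Longrightarrow> \<eta> (\<rho> x) (\<eta> x a) = a"
    and eta_phi: "\<lbrakk>x \<in> carrier X; y \<in> carrier X; a \<in> carrier (A x)\<rbrakk>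
          \<Longrightarrow> \<eta> (x \<triangleright> y) (\<phi> x y a) = \<phi> (\<rho> x) y (\<eta> x a)"
    and psi_ginv: "\<lbrakk>x \<in> carrier X; y \<in> carrier X; b \<in> carrier (A y)\<rbrakk>
          \<Longrightarrow> \<psi> (\<rho> x) y b = \<eta> (x \<triangleright> y) (\<psi> x y b)"
    and phi_ginv: "\<lbrakk>x \<in> carrier X; y \<in> carrier X; a \<in> carrier (A x)\<rbrakk>
          \<Longrightarrow> \<phi> (x \<triangleleft> y) y (\<phi> x (\<rho> y) a) = a"
    and psi_rop: "\<lbrakk>x \<in> carrier X; y \<in> carrier X; z \<in> carrier X; a \<in> carrier (A z)\<rbrakk>
          \<Longrightarrow> \<psi> (x \<triangleright> y) z a
              = \<phi> (x \<triangleright> z) (y \<triangleright> z) (\<psi> x z a)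
                \<otimes>\<^bsub>A ((x \<triangleright> y) \<triangleright> z)\<^esub> \<psi> (x \<triangleright> z) (y \<triangleright> z) (\<psi> y z a)"
    and phi_psi_eta: "\<lbrakk>x \<in> carrier X; y \<in> carrier X; b \<in> carrier (A y)\<rbrakk>
          \<Longrightarrow> \<phi> (x \<triangleleft> y) y (\<psi> x (\<rho> y) (\<eta> y b)) = inv\<^bsub>A x\<^esub> (\<psi> (x \<triangleright> \<rho> y) y b)"

definition sr_module_hom ::
  "'x symm_rack \<Rightarrow> ('x, 'a) sr_module \<Rightarrow> ('x, 'b) sr_module \<Rightarrow> ('x \<Rightarrow> 'a \<Rightarrow> 'b) set"
  where "sr_module_hom X M N =
    {f \<in> (\<Pi>\<^sub>E x \<in> carrier X. hom (mgrp M x) (mgrp N x) \<inter> extensional (carrier (mgrp M x))).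
      (\<forall>x \<in> carrier X. \<forall>y \<in> carrier X. \<forall>a \<in> carrier (mgrp M x).
        mphi N x y (f x a) = f (x \<triangleright>\<^bsub>X\<^esub> y) (mphi M x y a)) \<and>
      (\<forall>x \<in> carrier X. \<forall>y \<in> carrier X. \<forall>b \<in> carrier (mgrp M y).
        mpsi N x y (f y b) = f (x \<triangleright>\<^bsub>X\<^esub> y) (mpsi M x y b)) \<and>
      (\<forall>x \<in> carrier X. \<forall>a \<in> carrier (mgrp M x).
        meta N x (f x a) = f (\<rho>\<^bsub>X\<^esub> x) (meta M x a))}"

definition SRMod :: "'x symm_rack \<Rightarrow> (('x, 'a) sr_module, 'x \<Rightarrow> 'a \<Rightarrow> 'a) category"
  where "SRMod X =
    \<lparr>Obj = {M. sr_module X M},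
     Arr = sr_module_hom X,
     Ident = (\<lambda>M. \<lambda>x \<in> carrier X. \<lambda>a \<in> carrier (mgrp M x). a),
     Comp = (\<lambda>L M N g f. \<lambda>x \<in> carrier X. compose (carrier (mgrp L x)) (g x) (f x))\<rparr>"


section \<open>The slice category and its abelian group objects\<close>

record ('e, 'x) over =
  total_rack :: "'e symm_rack"
  proj :: "'e \<Rightarrow> 'x"

definition slice_object :: "'x symm_rack \<Rightarrow> ('e, 'x, 'z) over_scheme \<Rightarrow> bool"
  where "slice_object X E \<longleftrightarrow> symmetric_rack (total_rack E) \<and> proj E \<in> sr_hom (total_rack E) X"

definition slice_hom ::
  "('e, 'x, 'z) over_scheme \<Rightarrow> ('f, 'x, 'w) over_scheme \<Rightarrow> ('e \<Rightarrow> 'f) set"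
  where "slice_hom E F =
    {f \<in> sr_hom (total_rack E) (total_rack F). \<forall>u \<in> carrier (total_rack E). proj F (f u) = proj E u}"

definition slice_terminal :: "'x symm_rack \<Rightarrow> ('x, 'x) over"
  where "slice_terminal X = \<lparr>total_rack = X, proj = (\<lambda>x \<in> carrier X. x)\<rparr>"

definition slice_prod_carrier ::
  "('e, 'x, 'z) over_scheme \<Rightarrow> ('f, 'x, 'w) over_scheme \<Rightarrow> ('e \<times> 'f) set"
  where "slice_prod_carrier E F =
    {(u, v). u \<in> carrier (total_rack E) \<and> v \<in> carrier (total_rack F) \<and> proj E u = proj F v}"

definition slice_prod ::
  "('e, 'x, 'z) over_scheme \<Rightarrow> ('f, 'x, 'w) over_scheme \<Rightarrow> ('e \<times> 'f, 'x) over"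
  where "slice_prod E F =
    \<lparr>total_rack =
       \<lparr>carrier = slice_prod_carrier E F,
        rop = (\<lambda>(u, v) (u', v'). (u \<triangleright>\<^bsub>total_rack E\<^esub> u', v \<triangleright>\<^bsub>total_rack F\<^esub> v')),
        ginv = (\<lambda>(u, v). (\<rho>\<^bsub>total_rack E\<^esub> u, \<rho>\<^bsub>total_rack F\<^esub> v))\<rparr>,
     proj = (\<lambda>(u, v) \<in> slice_prod_carrier E F. proj E u)\<rparr>"

record ('e, 'x) group_object = "('e, 'x) over" +
  gmult :: "'e \<times> 'e \<Rightarrow> 'e"
  gunit :: "'x \<Rightarrow> 'e"
  ginverse :: "'e \<Rightarrow> 'e"

text \<open>
  The group diagrams are evaluated at elements of the (iterated) pullbacks. The unique map from
  \<open>G\<close> to the terminal object is \<open>proj G\<close>, so that the unit of the group object appears below as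
  \<open>gunit G (proj G a)\<close>.
\<close>

locale ab_group_object =
  fixes X :: "'x symm_rack" and G :: "('e, 'x) group_object"
  assumes object: "slice_object X G"
    and gmult_hom: "gmult G \<in> slice_hom (slice_prod G G) G"
    and gunit_hom: "gunit G \<in> slice_hom (slice_terminal X) G"
    and ginverse_hom: "ginverse G \<in> slice_hom G G"
    and gmult_assoc: "((a, b), c) \<in> carrier (total_rack (slice_prod (slice_prod G G) G))
          \<Longrightarrow> gmult G (gmult G (a, b), c) = gmult G (a, gmult G (b, c))"
    and gmult_comm: "(a, b) \<in> carrier (total_rack (slice_prod G G))
          \<Longrightarrow> gmult G (a, b) = gmult G (b, a)"
    and gmult_gunit: "a \<in> carrier (total_rack G) \<Longrightarrow> gmult G (gunit G (proj G a), a) = a"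
    and gmult_ginverse: "a \<in> carrier (total_rack G)
          \<Longrightarrow> gmult G (ginverse G a, a) = gunit G (proj G a)"

definition ab_group_hom ::
  "('e, 'x) group_object \<Rightarrow> ('f, 'x) group_object \<Rightarrow> ('e \<Rightarrow> 'f) set"
  where "ab_group_hom G H =
    {f \<in> slice_hom G H.
      \<forall>(a, b) \<in> carrier (total_rack (slice_prod G G)). f (gmult G (a, b)) = gmult H (f a, f b)}"

definition AbSR :: "'x symm_rack \<Rightarrow> (('e, 'x) group_object, 'e \<Rightarrow> 'e) category"
  where "AbSR X =
    \<lparr>Obj = {G. ab_group_object X G},
     Arr = ab_group_hom,
     Ident = (\<lambda>G. \<lambda>u \<in> carrier (total_rack G). u),
     Comp = (\<lambda>G H K g f. compose (carrier (total_rack G)) g f)\<rparr>"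

text \<open>
  Size: the type of carrier elements plays the role of the universe of small sets. The total
  space of a module is a disjoint union of its groups, so \<open>SRMod X\<close> and \<open>AbSR X\<close> are compared over
  one common element type \<open>'u\<close>, of class \<^class>\<open>infinite\<close>, in which \<open>X\<close> also lives; such a type is
  closed under pairs up to bijection. Over a finite type that disjoint union need not fit.
\<close>

end

theory Submission
  imports Defs
begin

text \<open>
  A module \<open>(A, \<phi>, \<psi>, \<eta>)\<close> yields the abelian group object with total space the disjoint
  union of the groups \<open>A x\<close>, with \<open>(x, a) * (y, b) = (x * y, \<phi> a + \<psi> b)\<close> and
  \<open>\<rho> (x, a) = (\<rho> x, \<eta> a)\<close>. Conversely, in an abelian group object the fibres are groups and
  \<open>\<phi> a = a * 0\<close>, \<open>\<psi> b = 0 * b\<close>, \<open>\<eta> a = \<rho> a\<close> make them a module; since the addition is a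
  homomorphism of racks, \<open>a * b = (a + 0) * (0 + b) = a * 0 + 0 * b\<close>, so the operation is
  recovered from \<open>\<phi>\<close> and \<open>\<psi>\<close>. Unit and counit are \<open>a \<mapsto> (x, a)\<close> and \<open>(x, a) \<mapsto> a\<close>.
\<close>

section \<open>Cancellation laws for the good involution\<close>

section \<open>Symmetric racks\<close>

context symmetric_rack
begin

text \<open>Translation by \<open>y\<close> is bijective, so the description defining
  \<open>x \<triangleleft> y\<close> has a unique witness. The axiom \<open>rop_ginv\<close> then
  becomes a plain equation, which serves as a rewrite rule.\<close>

lemma rop_ginv_rop:
  assumes "x \<in> carrier X" and "y \<in> carrier X"
  shows "(x \<triangleright> \<rho> y) \<triangleright> y = x"
proof -
  have "bij_betw (\<lambda>z. z \<triangleright> y) (carrier X) (carrier X)"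
    using rop_bij assms by simp
  then have "x \<in> (\<lambda>z. z \<triangleright> y) ` carrier X" and inj: "inj_on (\<lambda>z. z \<triangleright> y) (carrier X)"
    using assms(1) by (simp_all add: bij_betw_def)
  then obtain z where "z \<in> carrier X" "z \<triangleright> y = x"
    by blast
  then have "\<exists>!z. z \<in> carrier X \<and> z \<triangleright> y = x"
    using inj_onD[OF inj] by blast
  then have "x \<triangleleft> y \<in> carrier X \<and> (x \<triangleleft> y) \<triangleright> y = x"
    unfolding rop_inv_def by (rule theI')
  then show ?thesis
    using rop_ginv assms by simp
qed

lemma rop_rop_ginv:
  "\<lbrakk>x \<in> carrier X; y \<in> carrier X\<rbrakk> \<Longrightarrow> (x \<triangleright> y) \<triangleright> \<rho> y = x"
  using rop_ginv_rop[of x "\<rho> y"] by (simp add: ginv_closed ginv_ginv)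

end

text \<open>An equational characterisation: \<open>cancel\<close> stands for both bijectivity and
  the axiom about \<open>\<triangleleft>\<close>. Applied to \<open>\<rho> y\<close> it gives
  cancellation in the other order, so translation by \<open>\<rho> y\<close> is a two-sided inverse
  of translation by \<open>y\<close>.\<close>

lemma symmetric_rackI:
  fixes X (structure)
  assumes closed: "\<And>x y. \<lbrakk>x \<in> carrier X; y \<in> carrier X\<rbrakk> \<Longrightarrow> x \<triangleright> y \<in> carrier X"
    and distrib: "\<And>x y z. \<lbrakk>x \<in> carrier X; y \<in> carrier X; z \<in> carrier X\<rbrakk>
          \<Longrightarrow> (x \<triangleright> y) \<triangleright> z = (x \<triangleright> z) \<triangleright> (y \<triangleright> z)"
    and ginv: "\<And>x. x \<in> carrier X \<Longrightarrow> \<rho> x \<in> carrier X"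
    and invol: "\<And>x. x \<in> carrier X \<Longrightarrow> \<rho> (\<rho> x) = x"
    and ginv_rop: "\<And>x y. \<lbrakk>x \<in> carrier X; y \<in> carrier X\<rbrakk> \<Longrightarrow> \<rho> (x \<triangleright> y) = \<rho> x \<triangleright> y"
    and cancel: "\<And>x y. \<lbrakk>x \<in> carrier X; y \<in> carrier X\<rbrakk> \<Longrightarrow> (x \<triangleright> \<rho> y) \<triangleright> y = x"
  shows "symmetric_rack X"
proof -
  have cancel': "(x \<triangleright> y) \<triangleright> \<rho> y = x" if "x \<in> carrier X" "y \<in> carrier X" for x y
    using cancel[of x "\<rho> y"] that by (simp add: ginv invol)
  show ?thesis
  proof unfold_locales
    fix y assume y: "y \<in> carrier X"
    show "bij_betw (\<lambda>x. x \<triangleright> y) (carrier X) (carrier X)"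
      by (rule bij_betw_byWitness[where f' = "\<lambda>x. x \<triangleright> \<rho> y"])
        (use y in \<open>auto simp: cancel cancel' closed ginv\<close>)
    fix x assume x: "x \<in> carrier X"
    show "x \<triangleright> \<rho> y = x \<triangleleft> y"
      unfolding rop_inv_def
      by (rule the_equality[symmetric]) (use x y in \<open>auto simp: cancel cancel' closed ginv\<close>)
  qed (rule assms; assumption)+
qed

section \<open>The action \<open>\<phi> a + \<psi> b\<close> of a module and its laws\<close>

section \<open>Modules\<close>

text \<open>The fibre coordinate of the product of \<open>(x, a)\<close> and \<open>(y, b)\<close>
  in the total space. The laws proved for it below are the coordinate parts of the laws of the
  abelian group object.\<close>

definition module_act ::
  "'x symm_rack \<Rightarrow> ('x, 'a) sr_module \<Rightarrow> 'x \<Rightarrow> 'x \<Rightarrow> 'a \<Rightarrow> 'a \<Rightarrow> 'a"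
  where "module_act X M x y a b = mphi M x y a \<otimes>\<^bsub>mgrp M (x \<triangleright>\<^bsub>X\<^esub> y)\<^esub> mpsi M x y b"

lemma hom_inverse:
  "\<lbrakk>h \<in> hom G H; group G; group H; x \<in> carrier G\<rbrakk> \<Longrightarrow> h (inv\<^bsub>G\<^esub> x) = inv\<^bsub>H\<^esub> (h x)"
  by (simp add: group_hom.hom_inv group_hom.intro group_hom_axioms.intro)

text \<open>The predicate \<open>sr_module\<close> does not include the rack axioms for
  \<open>X\<close>; they are joined to it here.\<close>

locale module_over_rack = symmetric_rack X for X :: "'x symm_rack" (structure) +
  fixes M :: "('x, 'a) sr_module"
  assumes module: "sr_module X M"
begin

abbreviation "A \<equiv> mgrp M"
abbreviation "\<phi> \<equiv> mphi M"
abbreviation "\<psi> \<equiv> mpsi M"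
abbreviation "\<eta> \<equiv> meta M"
abbreviation "act \<equiv> module_act X M"

lemmas comm_grp = sr_module.grp[OF module]
lemmas phi_hom = sr_module.phi_iso[OF module, THEN iso_imp_homomorphism]
lemmas psi_hom = sr_module.psi_hom[OF module]
lemmas eta_hom = sr_module.eta_hom[OF module]
lemmas phi_phi = sr_module.phi_phi[OF module]
lemmas phi_psi = sr_module.phi_psi[OF module]
lemmas eta_eta = sr_module.eta_eta[OF module]
lemmas eta_phi = sr_module.eta_phi[OF module]
lemmas psi_ginv = sr_module.psi_ginv[OF module]
lemmas psi_rop = sr_module.psi_rop[OF module]

lemma grp: "x \<in> carrier X \<Longrightarrow> group (A x)"
  using comm_grp comm_group.axioms(2) by blast

lemma phi_ginv:
  "\<lbrakk>x \<in> carrier X; y \<in> carrier X; a \<in> carrier (A x)\<rbrakk> \<Longrightarrow> \<phi> (x \<triangleright> \<rho> y) y (\<phi> x (\<rho> y) a) = a"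
  using sr_module.phi_ginv[OF module] by (simp add: rop_ginv)

lemma phi_psi_eta:
  "\<lbrakk>x \<in> carrier X; y \<in> carrier X; b \<in> carrier (A y)\<rbrakk>
    \<Longrightarrow> \<phi> (x \<triangleright> \<rho> y) y (\<psi> x (\<rho> y) (\<eta> y b)) = inv\<^bsub>A x\<^esub> (\<psi> (x \<triangleright> \<rho> y) y b)"
  using sr_module.phi_psi_eta[OF module] by (simp add: rop_ginv)

lemma phi_closed:
  "\<lbrakk>x \<in> carrier X; y \<in> carrier X; a \<in> carrier (A x)\<rbrakk> \<Longrightarrow> \<phi> x y a \<in> carrier (A (x \<triangleright> y))"
  using phi_hom hom_in_carrier by metis

lemma psi_closed:
  "\<lbrakk>x \<in> carrier X; y \<in> carrier X; b \<in> carrier (A y)\<rbrakk> \<Longrightarrow> \<psi> x y b \<in> carrier (A (x \<triangleright> y))"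
  using psi_hom hom_in_carrier by metis

lemma eta_closed:
  "\<lbrakk>x \<in> carrier X; a \<in> carrier (A x)\<rbrakk> \<Longrightarrow> \<eta> x a \<in> carrier (A (\<rho> x))"
  using eta_hom hom_in_carrier by metis

lemma mult_closed:
  "\<lbrakk>x \<in> carrier X; a \<in> carrier (A x); b \<in> carrier (A x)\<rbrakk> \<Longrightarrow> a \<otimes>\<^bsub>A x\<^esub> b \<in> carrier (A x)"
  using grp group.is_monoid monoid.m_closed by metis

lemma one_closed: "x \<in> carrier X \<Longrightarrow> \<one>\<^bsub>A x\<^esub> \<in> carrier (A x)"
  using grp group.is_monoid monoid.one_closed by metis

lemma inv_closed: "\<lbrakk>x \<in> carrier X; a \<in> carrier (A x)\<rbrakk> \<Longrightarrow> inv\<^bsub>A x\<^esub> a \<in> carrier (A x)"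
  using grp group.inv_closed by metis

lemmas closed = rop_closed ginv_closed phi_closed psi_closed eta_closed
  mult_closed one_closed inv_closed

lemma act_closed:
  "\<lbrakk>x \<in> carrier X; y \<in> carrier X; a \<in> carrier (A x); b \<in> carrier (A y)\<rbrakk>
    \<Longrightarrow> act x y a b \<in> carrier (A (x \<triangleright> y))"
  by (simp add: module_act_def closed)

text \<open>The left side is a product of three terms; \<open>psi_rop\<close> splits the one in
  \<open>c\<close> into two, while \<open>phi_phi\<close> and \<open>phi_psi\<close> bring the other
  two into the form they have on the right. The four terms then differ from the right side only by
  an exchange of the middle two, which is where commutativity enters.\<close>

lemma act_distrib:
  assumes x: "x \<in> carrier X" "y \<in> carrier X" "z \<in> carrier X"
    and a: "a \<in> carrier (A x)" "b \<in> carrier (A y)" "c \<in> carrier (A z)"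
  shows "act (x \<triangleright> y) z (act x y a b) c = act (x \<triangleright> z) (y \<triangleright> z) (act x z a c) (act y z b c)"
proof -
  let ?w = "(x \<triangleright> y) \<triangleright> z"
  \<comment> \<open>The rewritten terms naturally lie over the right side, but the module axioms
    form their products over the left side; self-distributivity in \<open>X\<close> identifies the
    two groups.\<close>
  have w: "?w = (x \<triangleright> z) \<triangleright> (y \<triangleright> z)"
    by (rule rop_distrib[OF x])
  have wX: "?w \<in> carrier X"
    using x by (simp add: closed)
  interpret W: comm_group "A ?w" using comm_grp wX .
  have c1: "\<phi> (x \<triangleright> z) (y \<triangleright> z) (\<phi> x z a) \<in> carrier (A ?w)"
    "\<phi> (x \<triangleright> z) (y \<triangleright> z) (\<psi> x z c) \<in> carrier (A ?w)"
    "\<psi> (x \<triangleright> z) (y \<triangleright> z) (\<phi> y z b) \<in> carrier (A ?w)"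
    "\<psi> (x \<triangleright> z) (y \<triangleright> z) (\<psi> y z c) \<in> carrier (A ?w)"
    unfolding w using x a by (simp_all add: closed)
  have "act (x \<triangleright> y) z (act x y a b) c
      = \<phi> (x \<triangleright> y) z (\<phi> x y a) \<otimes>\<^bsub>A ?w\<^esub> \<phi> (x \<triangleright> y) z (\<psi> x y b) \<otimes>\<^bsub>A ?w\<^esub> \<psi> (x \<triangleright> y) z c"
    using x a by (simp add: module_act_def closed hom_mult[OF phi_hom])
  also have "\<dots> = \<phi> (x \<triangleright> z) (y \<triangleright> z) (\<phi> x z a) \<otimes>\<^bsub>A ?w\<^esub> \<psi> (x \<triangleright> z) (y \<triangleright> z) (\<phi> y z b)
      \<otimes>\<^bsub>A ?w\<^esub> (\<phi> (x \<triangleright> z) (y \<triangleright> z) (\<psi> x z c) \<otimes>\<^bsub>A ?w\<^esub> \<psi> (x \<triangleright> z) (y \<triangleright> z) (\<psi> y z c))"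
    by (simp only: phi_phi[OF x a(1)] phi_psi[OF x a(2)] psi_rop[OF x a(3)])
  also have "\<dots> = (\<phi> (x \<triangleright> z) (y \<triangleright> z) (\<phi> x z a) \<otimes>\<^bsub>A ?w\<^esub> \<phi> (x \<triangleright> z) (y \<triangleright> z) (\<psi> x z c))
      \<otimes>\<^bsub>A ?w\<^esub> (\<psi> (x \<triangleright> z) (y \<triangleright> z) (\<phi> y z b) \<otimes>\<^bsub>A ?w\<^esub> \<psi> (x \<triangleright> z) (y \<triangleright> z) (\<psi> y z c))"
    using c1 by (simp add: W.m_ac)
  also have "\<dots> = act (x \<triangleright> z) (y \<triangleright> z) (act x z a c) (act y z b c)"
    unfolding w using x a by (simp add: module_act_def closed hom_mult[OF phi_hom] hom_mult[OF psi_hom])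
  finally show ?thesis .
qed

lemma eta_act:
  "\<lbrakk>x \<in> carrier X; y \<in> carrier X; a \<in> carrier (A x); b \<in> carrier (A y)\<rbrakk>
    \<Longrightarrow> \<eta> (x \<triangleright> y) (act x y a b) = act (\<rho> x) y (\<eta> x a) b"
  by (simp add: module_act_def closed hom_mult[OF eta_hom] eta_phi psi_ginv ginv_rop)

text \<open>Cancellation in the total space. The inner action, moved by \<open>\<phi>\<close>,
  becomes \<open>a\<close> minus \<open>\<psi> b\<close> by \<open>phi_ginv\<close> and
  \<open>phi_psi_eta\<close>; the outer action adds \<open>\<psi> b\<close> back.\<close>

lemma act_eta_act:
  assumes x: "x \<in> carrier X" "y \<in> carrier X"
    and a: "a \<in> carrier (A x)" "b \<in> carrier (A y)"
  shows "act (x \<triangleright> \<rho> y) y (act x (\<rho> y) a (\<eta> y b)) b = a"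
proof -
  interpret comm_group "A x" using comm_grp x(1) .
  have x': "(x \<triangleright> \<rho> y) \<triangleright> y = x" "x \<triangleright> \<rho> y \<in> carrier X"
    using x by (simp_all add: rop_ginv_rop closed)
  have c: "\<psi> (x \<triangleright> \<rho> y) y b \<in> carrier (A x)"
    using psi_closed[OF x'(2) x(2) a(2)] x' by simp
  have "\<phi> (x \<triangleright> \<rho> y) y (act x (\<rho> y) a (\<eta> y b)) = a \<otimes>\<^bsub>A x\<^esub> inv\<^bsub>A x\<^esub> (\<psi> (x \<triangleright> \<rho> y) y b)"
    using x x' a hom_mult[OF phi_hom[OF x'(2) x(2)]]
    by (simp add: module_act_def closed phi_ginv phi_psi_eta)
  then show ?thesis
    using x' a c by (simp add: module_act_def[of _ _ "x \<triangleright> \<rho> y"] m_assoc)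
qed

text \<open>Since \<open>\<phi>\<close> and \<open>\<psi>\<close> are homomorphisms into a
  commutative group, their sum is additive in both arguments jointly. This makes fibrewise addition
  compatible with the rack operation.\<close>

lemma act_mult:
  assumes x: "x \<in> carrier X" "y \<in> carrier X"
    and a: "a \<in> carrier (A x)" "a' \<in> carrier (A x)" "b \<in> carrier (A y)" "b' \<in> carrier (A y)"
  shows "act x y (a \<otimes>\<^bsub>A x\<^esub> a') (b \<otimes>\<^bsub>A y\<^esub> b') = act x y a b \<otimes>\<^bsub>A (x \<triangleright> y)\<^esub> act x y a' b'"
proof -
  interpret comm_group "A (x \<triangleright> y)" using comm_grp x by (simp add: closed)
  have "\<phi> x y a \<in> carrier (A (x \<triangleright> y))" "\<phi> x y a' \<in> carrier (A (x \<triangleright> y))"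
    "\<psi> x y b \<in> carrier (A (x \<triangleright> y))" "\<psi> x y b' \<in> carrier (A (x \<triangleright> y))"
    using x a by (simp_all add: closed)
  then show ?thesis
    using x a by (simp add: module_act_def hom_mult[OF phi_hom] hom_mult[OF psi_hom] m_ac)
qed

lemma phi_one: "\<lbrakk>x \<in> carrier X; y \<in> carrier X\<rbrakk> \<Longrightarrow> \<phi> x y \<one>\<^bsub>A x\<^esub> = \<one>\<^bsub>A (x \<triangleright> y)\<^esub>"
  by (rule hom_one[OF phi_hom]) (simp_all add: grp closed)

lemma psi_one: "\<lbrakk>x \<in> carrier X; y \<in> carrier X\<rbrakk> \<Longrightarrow> \<psi> x y \<one>\<^bsub>A y\<^esub> = \<one>\<^bsub>A (x \<triangleright> y)\<^esub>"
  by (rule hom_one[OF psi_hom]) (simp_all add: grp closed)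

lemma eta_one: "x \<in> carrier X \<Longrightarrow> \<eta> x \<one>\<^bsub>A x\<^esub> = \<one>\<^bsub>A (\<rho> x)\<^esub>"
  by (rule hom_one[OF eta_hom]) (simp_all add: grp closed)

text \<open>Acting with a zero element recovers a structure map, here \<open>\<phi>\<close> and in
  the next lemma \<open>\<psi>\<close>. Hence the fibres of the total space return the module one
  started from.\<close>

lemma act_one_right:
  assumes "x \<in> carrier X" "y \<in> carrier X" "a \<in> carrier (A x)"
  shows "act x y a \<one>\<^bsub>A y\<^esub> = \<phi> x y a"
proof -
  interpret comm_group "A (x \<triangleright> y)" using comm_grp assms by (simp add: closed)
  show ?thesis using assms by (simp add: module_act_def psi_one closed)
qed

lemma act_one_left:
  assumes "x \<in> carrier X" "y \<in> carrier X" "b \<in> carrier (A y)"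
  shows "act x y \<one>\<^bsub>A x\<^esub> b = \<psi> x y b"
proof -
  interpret comm_group "A (x \<triangleright> y)" using comm_grp assms by (simp add: closed)
  show ?thesis using assms by (simp add: module_act_def phi_one closed)
qed

lemma act_inv:
  assumes x: "x \<in> carrier X" "y \<in> carrier X" and a: "a \<in> carrier (A x)" "b \<in> carrier (A y)"
  shows "act x y (inv\<^bsub>A x\<^esub> a) (inv\<^bsub>A y\<^esub> b) = inv\<^bsub>A (x \<triangleright> y)\<^esub> (act x y a b)"
proof -
  interpret comm_group "A (x \<triangleright> y)" using comm_grp x by (simp add: closed)
  show ?thesis
    using x a by (simp add: module_act_def hom_inverse[OF phi_hom] hom_inverse[OF psi_hom]
        grp closed inv_mult)
qed

lemma eta_inv:
  "\<lbrakk>x \<in> carrier X; a \<in> carrier (A x)\<rbrakk> \<Longrightarrow> \<eta> x (inv\<^bsub>A x\<^esub> a) = inv\<^bsub>A (\<rho> x)\<^esub> (\<eta> x a)"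
  by (rule hom_inverse[OF eta_hom]) (simp_all add: grp closed)

end

lemma module_over_rackI:
  "\<lbrakk>symmetric_rack X; sr_module X M\<rbrakk> \<Longrightarrow> module_over_rack X M"
  by (simp add: module_over_rack_def module_over_rack_axioms_def)

section \<open>Extensional morphisms and the category of modules\<close>

section \<open>Morphisms and the two categories\<close>

lemma sr_module_homI:
  assumes "f \<in> extensional (carrier X)"
    and "\<And>x. x \<in> carrier X \<Longrightarrow> f x \<in> extensional (carrier (mgrp M x))"
    and "\<And>x. x \<in> carrier X \<Longrightarrow> f x \<in> hom (mgrp M x) (mgrp N x)"
    and "\<And>x y a. \<lbrakk>x \<in> carrier X; y \<in> carrier X; a \<in> carrier (mgrp M x)\<rbrakk>
        \<Longrightarrow> mphi N x y (f x a) = f (x \<triangleright>\<^bsub>X\<^esub> y) (mphi M x y a)"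
    and "\<And>x y b. \<lbrakk>x \<in> carrier X; y \<in> carrier X; b \<in> carrier (mgrp M y)\<rbrakk>
        \<Longrightarrow> mpsi N x y (f y b) = f (x \<triangleright>\<^bsub>X\<^esub> y) (mpsi M x y b)"
    and "\<And>x a. \<lbrakk>x \<in> carrier X; a \<in> carrier (mgrp M x)\<rbrakk>
        \<Longrightarrow> meta N x (f x a) = f (\<rho>\<^bsub>X\<^esub> x) (meta M x a)"
  shows "f \<in> sr_module_hom X M N"
  using assms unfolding sr_module_hom_def by (auto simp: PiE_def)

lemma sr_module_homD:
  assumes "f \<in> sr_module_hom X M N"
  shows "f \<in> extensional (carrier X)"
    and "x \<in> carrier X \<Longrightarrow> f x \<in> extensional (carrier (mgrp M x))"
    and "x \<in> carrier X \<Longrightarrow> f x \<in> hom (mgrp M x) (mgrp N x)"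
    and "\<lbrakk>x \<in> carrier X; y \<in> carrier X; a \<in> carrier (mgrp M x)\<rbrakk>
        \<Longrightarrow> mphi N x y (f x a) = f (x \<triangleright>\<^bsub>X\<^esub> y) (mphi M x y a)"
    and "\<lbrakk>x \<in> carrier X; y \<in> carrier X; b \<in> carrier (mgrp M y)\<rbrakk>
        \<Longrightarrow> mpsi N x y (f y b) = f (x \<triangleright>\<^bsub>X\<^esub> y) (mpsi M x y b)"
    and "\<lbrakk>x \<in> carrier X; a \<in> carrier (mgrp M x)\<rbrakk>
        \<Longrightarrow> meta N x (f x a) = f (\<rho>\<^bsub>X\<^esub> x) (meta M x a)"
  using assms unfolding sr_module_hom_def by (auto simp: PiE_def Pi_def)

lemma sr_module_hom_closed:
  "\<lbrakk>f \<in> sr_module_hom X M N; x \<in> carrier X; a \<in> carrier (mgrp M x)\<rbrakk>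
    \<Longrightarrow> f x a \<in> carrier (mgrp N x)"
  using sr_module_homD(3) hom_in_carrier by metis

text \<open>Module morphisms are extensional in two layers, in the index and in the element of each
  group. Equality therefore has to be tested only at genuine elements, which makes the category laws
  pointwise.\<close>

lemma family_eqI:
  assumes "f \<in> extensional S" "g \<in> extensional S"
    and "\<And>x. x \<in> S \<Longrightarrow> f x \<in> extensional (T x)" "\<And>x. x \<in> S \<Longrightarrow> g x \<in> extensional (T x)"
    and "\<And>x a. \<lbrakk>x \<in> S; a \<in> T x\<rbrakk> \<Longrightarrow> f x a = g x a"
  shows "f = g"
  by (rule extensionalityI[OF assms(1,2)], rule extensionalityI[OF assms(3,4)])
    (simp_all add: assms(5))

lemma sr_module_hom_Ident:
  assumes "symmetric_rack X" "sr_module X M"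
  shows "Ident (SRMod X) M \<in> sr_module_hom X M M"
proof -
  interpret module_over_rack X M
    by (rule module_over_rackI[OF assms(1,2)])
  show ?thesis
    by (rule sr_module_homI) (auto simp: SRMod_def closed hom_def)
qed

lemma sr_module_hom_Comp:
  assumes "symmetric_rack X" "sr_module X L"
    and f: "f \<in> sr_module_hom X L M" and g: "g \<in> sr_module_hom X M N"
  shows "Comp (SRMod X) L M N g f \<in> sr_module_hom X L N"
proof -
  interpret module_over_rack X L
    by (rule module_over_rackI[OF assms(1,2)])
  note fD = sr_module_homD[OF f] sr_module_hom_closed[OF f]
  note gD = sr_module_homD[OF g] sr_module_hom_closed[OF g]
  show ?thesis
  proof (rule sr_module_homI)
    fix x assume x: "x \<in> carrier X"
    show "Comp (SRMod X) L M N g f x \<in> hom (mgrp L x) (mgrp N x)"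
      using x by (auto intro!: homI simp: SRMod_def compose_eq closed fD gD
          hom_mult[OF fD(3)] hom_mult[OF gD(3)])
  qed (auto simp: SRMod_def compose_eq closed fD gD)
qed

lemma category_SRMod:
  fixes X :: "'x symm_rack"
  assumes X: "symmetric_rack X"
  shows "category (SRMod X :: (('x, 'a) sr_module, 'x \<Rightarrow> 'a \<Rightarrow> 'a) category)"
proof
  fix L M :: "('x, 'a) sr_module"
  assume L: "L \<in> Obj (SRMod X)"
  then have L': "sr_module X L" by (simp add: SRMod_def)
  show "Ident (SRMod X) L \<in> Arr (SRMod X) L L"
    using sr_module_hom_Ident[OF X L'] by (simp add: SRMod_def)
  fix f assume "f \<in> Arr (SRMod X) L M"
  then have f: "f \<in> sr_module_hom X L M" by (simp add: SRMod_def)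
  note fD = sr_module_homD[OF f] sr_module_hom_closed[OF f]
  show "Comp (SRMod X) L M M (Ident (SRMod X) M) f = f"
    by (rule family_eqI[of _ "carrier X" _ "\<lambda>x. carrier (mgrp L x)"])
      (auto simp: SRMod_def compose_eq fD)
  show "Comp (SRMod X) L L M f (Ident (SRMod X) L) = f"
    by (rule family_eqI[of _ "carrier X" _ "\<lambda>x. carrier (mgrp L x)"])
      (auto simp: SRMod_def compose_eq fD)
  fix N :: "('x, 'a) sr_module" and g
  assume "g \<in> Arr (SRMod X) M N"
  then have g: "g \<in> sr_module_hom X M N" by (simp add: SRMod_def)
  show "Comp (SRMod X) L M N g f \<in> Arr (SRMod X) L N"
    using sr_module_hom_Comp[OF X L' f g] by (simp add: SRMod_def)
  fix K :: "('x, 'a) sr_module" and h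
  assume "h \<in> Arr (SRMod X) N K"
  show "Comp (SRMod X) L N K h (Comp (SRMod X) L M N g f)
      = Comp (SRMod X) L M K (Comp (SRMod X) M N K h g) f"
    by (rule family_eqI[of _ "carrier X" _ "\<lambda>x. carrier (mgrp L x)"])
      (auto simp: SRMod_def compose_eq fD)
qed

section \<open>Slice morphisms and pullbacks, elementwise\<close>

lemma slice_homI:
  assumes "f \<in> extensional (carrier (total_rack E))"
    and "\<And>u. u \<in> carrier (total_rack E) \<Longrightarrow> f u \<in> carrier (total_rack F)"
    and "\<And>u. u \<in> carrier (total_rack E) \<Longrightarrow> proj F (f u) = proj E u"
    and "\<And>u v. \<lbrakk>u \<in> carrier (total_rack E); v \<in> carrier (total_rack E)\<rbrakk>
        \<Longrightarrow> f (u \<triangleright>\<^bsub>total_rack E\<^esub> v) = f u \<triangleright>\<^bsub>total_rack F\<^esub> f v"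
    and "\<And>u. u \<in> carrier (total_rack E) \<Longrightarrow> f (\<rho>\<^bsub>total_rack E\<^esub> u) = \<rho>\<^bsub>total_rack F\<^esub> (f u)"
  shows "f \<in> slice_hom E F"
  using assms unfolding slice_hom_def sr_hom_def by (auto simp: PiE_def)

lemma slice_homD:
  assumes "f \<in> slice_hom E F"
  shows "f \<in> extensional (carrier (total_rack E))"
    and "u \<in> carrier (total_rack E) \<Longrightarrow> f u \<in> carrier (total_rack F)"
    and "u \<in> carrier (total_rack E) \<Longrightarrow> proj F (f u) = proj E u"
    and "\<lbrakk>u \<in> carrier (total_rack E); v \<in> carrier (total_rack E)\<rbrakk>
        \<Longrightarrow> f (u \<triangleright>\<^bsub>total_rack E\<^esub> v) = f u \<triangleright>\<^bsub>total_rack F\<^esub> f v"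
    and "u \<in> carrier (total_rack E) \<Longrightarrow> f (\<rho>\<^bsub>total_rack E\<^esub> u) = \<rho>\<^bsub>total_rack F\<^esub> (f u)"
  using assms unfolding slice_hom_def sr_hom_def by (auto simp: PiE_def Pi_def)

text \<open>The projection of a pullback is a restricted function, hence the membership premises of
  the last clause; operation and involution are given by unrestricted formulas.\<close>

lemma slice_prod_simps:
  "(u, v) \<in> carrier (total_rack (slice_prod E F))
    \<longleftrightarrow> u \<in> carrier (total_rack E) \<and> v \<in> carrier (total_rack F) \<and> proj E u = proj F v"
  "(u, v) \<triangleright>\<^bsub>total_rack (slice_prod E F)\<^esub> (u', v')
    = (u \<triangleright>\<^bsub>total_rack E\<^esub> u', v \<triangleright>\<^bsub>total_rack F\<^esub> v')"
  "\<rho>\<^bsub>total_rack (slice_prod E F)\<^esub> (u, v) = (\<rho>\<^bsub>total_rack E\<^esub> u, \<rho>\<^bsub>total_rack F\<^esub> v)"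
  "\<lbrakk>u \<in> carrier (total_rack E); v \<in> carrier (total_rack F); proj E u = proj F v\<rbrakk>
    \<Longrightarrow> proj (slice_prod E F) (u, v) = proj E u"
  by (simp_all add: slice_prod_def slice_prod_carrier_def)

lemma ab_group_homI:
  assumes "f \<in> slice_hom G H"
    and "\<And>u v. \<lbrakk>u \<in> carrier (total_rack G); v \<in> carrier (total_rack G); proj G u = proj G v\<rbrakk>
        \<Longrightarrow> f (gmult G (u, v)) = gmult H (f u, f v)"
  shows "f \<in> ab_group_hom G H"
  using assms unfolding ab_group_hom_def by (auto simp: slice_prod_simps)

lemma ab_group_homD:
  assumes "f \<in> ab_group_hom G H"
  shows "f \<in> slice_hom G H"
    and "\<lbrakk>u \<in> carrier (total_rack G); v \<in> carrier (total_rack G); proj G u = proj G v\<rbrakk>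
        \<Longrightarrow> f (gmult G (u, v)) = gmult H (f u, f v)"
  using assms unfolding ab_group_hom_def by (auto simp: slice_prod_simps)

section \<open>From abelian group objects to modules: the fibres\<close>

section \<open>Abelian group objects\<close>

definition fiber :: "('e, 'x) group_object \<Rightarrow> 'x \<Rightarrow> 'e monoid"
  where "fiber G x =
    \<lparr>carrier = {u \<in> carrier (total_rack G). proj G u = x},
     mult = (\<lambda>u v. gmult G (u, v)),
     one = gunit G x\<rparr>"

definition fiber_module :: "('e, 'x) group_object \<Rightarrow> ('x, 'e) sr_module"
  where "fiber_module G =
    \<lparr>mgrp = fiber G,
     mphi = (\<lambda>x y a. a \<triangleright>\<^bsub>total_rack G\<^esub> gunit G y),
     mpsi = (\<lambda>x y b. gunit G x \<triangleright>\<^bsub>total_rack G\<^esub> b),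
     meta = (\<lambda>x a. \<rho>\<^bsub>total_rack G\<^esub> a)\<rparr>"

locale group_object_over_rack = symmetric_rack X for X :: "'x symm_rack" (structure) +
  fixes G :: "('e, 'x) group_object"
  assumes group_object: "ab_group_object X G"
begin

abbreviation "E \<equiv> total_rack G"
abbreviation "p \<equiv> proj G"
abbreviation "zero \<equiv> gunit G"
abbreviation "add u v \<equiv> gmult G (u, v)"

sublocale E: symmetric_rack E
  using ab_group_object.object[OF group_object] by (simp add: slice_object_def)

lemma proj_hom: "p \<in> sr_hom E X"
  using ab_group_object.object[OF group_object] by (simp add: slice_object_def)

lemma proj_closed: "u \<in> carrier E \<Longrightarrow> p u \<in> carrier X"
  using proj_hom by (auto simp: sr_hom_def)

lemma proj_rop: "\<lbrakk>u \<in> carrier E; v \<in> carrier E\<rbrakk> \<Longrightarrow> p (u \<triangleright>\<^bsub>E\<^esub> v) = p u \<triangleright> p v"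
  using proj_hom by (auto simp: sr_hom_def)

lemma proj_ginv: "u \<in> carrier E \<Longrightarrow> p (\<rho>\<^bsub>E\<^esub> u) = \<rho> (p u)"
  using proj_hom by (auto simp: sr_hom_def)

lemmas gmultD = slice_homD[OF ab_group_object.gmult_hom[OF group_object]]

lemma add_closed: "\<lbrakk>u \<in> carrier E; v \<in> carrier E; p u = p v\<rbrakk> \<Longrightarrow> add u v \<in> carrier E"
  by (rule gmultD(2)) (simp add: slice_prod_simps)

lemma proj_add: "\<lbrakk>u \<in> carrier E; v \<in> carrier E; p u = p v\<rbrakk> \<Longrightarrow> p (add u v) = p u"
  by (subst gmultD(3)) (simp_all add: slice_prod_simps)

lemma add_rop:
  "\<lbrakk>u \<in> carrier E; v \<in> carrier E; p u = p v; u' \<in> carrier E; v' \<in> carrier E; p u' = p v'\<rbrakk>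
    \<Longrightarrow> add u v \<triangleright>\<^bsub>E\<^esub> add u' v' = add (u \<triangleright>\<^bsub>E\<^esub> u') (v \<triangleright>\<^bsub>E\<^esub> v')"
  using gmultD(4)[of "(u, v)" "(u', v')"] by (simp add: slice_prod_simps)

lemma add_ginv:
  "\<lbrakk>u \<in> carrier E; v \<in> carrier E; p u = p v\<rbrakk> \<Longrightarrow> \<rho>\<^bsub>E\<^esub> (add u v) = add (\<rho>\<^bsub>E\<^esub> u) (\<rho>\<^bsub>E\<^esub> v)"
  using gmultD(5)[of "(u, v)"] by (simp add: slice_prod_simps)

lemmas gunitD = slice_homD[OF ab_group_object.gunit_hom[OF group_object], unfolded slice_terminal_def,
    simplified]

lemma zero_closed: "x \<in> carrier X \<Longrightarrow> zero x \<in> carrier E"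
  by (rule gunitD(2))

lemma proj_zero: "x \<in> carrier X \<Longrightarrow> p (zero x) = x"
  using gunitD(3) by simp

lemma zero_rop: "\<lbrakk>x \<in> carrier X; y \<in> carrier X\<rbrakk> \<Longrightarrow> zero (x \<triangleright> y) = zero x \<triangleright>\<^bsub>E\<^esub> zero y"
  by (rule gunitD(4))

lemma zero_ginv: "x \<in> carrier X \<Longrightarrow> zero (\<rho> x) = \<rho>\<^bsub>E\<^esub> (zero x)"
  by (rule gunitD(5))

lemmas ginverseD = slice_homD[OF ab_group_object.ginverse_hom[OF group_object]]

lemma add_assoc:
  "\<lbrakk>u \<in> carrier E; v \<in> carrier E; w \<in> carrier E; p u = p v; p v = p w\<rbrakk>
    \<Longrightarrow> add (add u v) w = add u (add v w)"
  by (rule ab_group_object.gmult_assoc[OF group_object]) (simp add: slice_prod_simps)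

lemma add_commute:
  "\<lbrakk>u \<in> carrier E; v \<in> carrier E; p u = p v\<rbrakk> \<Longrightarrow> add u v = add v u"
  by (rule ab_group_object.gmult_comm[OF group_object]) (simp add: slice_prod_simps)

lemma zero_add: "\<lbrakk>u \<in> carrier E; p u = x\<rbrakk> \<Longrightarrow> add (zero x) u = u"
  using ab_group_object.gmult_gunit[OF group_object] by blast

lemma add_zero: "\<lbrakk>u \<in> carrier E; p u = x\<rbrakk> \<Longrightarrow> add u (zero x) = u"
  using zero_add add_commute[of u "zero x"] by (auto simp: zero_closed proj_zero proj_closed)

lemma neg_add: "\<lbrakk>u \<in> carrier E; p u = x\<rbrakk> \<Longrightarrow> add (ginverse G u) u = zero x"
  using ab_group_object.gmult_ginverse[OF group_object] by blast

lemmas closed = rop_closed ginv_closed E.rop_closed E.ginv_closed zero_closed add_closed proj_closed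
lemmas proj_simps = proj_rop proj_ginv proj_add proj_zero

text \<open>The record \<open>fiber\<close> carries no inversion; inverses exist because
  \<open>ginverse G\<close>, being a slice morphism, keeps each fibre.\<close>

lemma comm_group_fiber: "x \<in> carrier X \<Longrightarrow> comm_group (fiber G x)"
proof (rule comm_groupI)
  fix u assume "x \<in> carrier X" and u: "u \<in> carrier (fiber G x)"
  then show "\<exists>v \<in> carrier (fiber G x). v \<otimes>\<^bsub>fiber G x\<^esub> u = \<one>\<^bsub>fiber G x\<^esub>"
    by (intro bexI[of _ "ginverse G u"]) (auto simp: fiber_def neg_add ginverseD)
qed (auto simp: fiber_def closed proj_simps add_assoc zero_add intro: add_commute)

text \<open>The interchange law \<open>add_rop\<close> applied to \<open>a + 0\<close> and
  \<open>0 + b\<close>. It is the source of the module axioms that contain a sum or an inverse, and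
  later of the compatibility of the counit with the operation.\<close>

lemma rop_decompose:
  assumes "a \<in> carrier E" "b \<in> carrier E"
  shows "add (a \<triangleright>\<^bsub>E\<^esub> zero (p b)) (zero (p a) \<triangleright>\<^bsub>E\<^esub> b) = a \<triangleright>\<^bsub>E\<^esub> b"
  using assms add_rop[of a "zero (p a)" "zero (p b)" b]
  by (simp add: closed proj_simps zero_add add_zero)

text \<open>The axioms relating \<open>\<phi>\<close>, \<open>\<psi>\<close> and
  \<open>\<eta>\<close> without sums or inverses are rack laws of the total space with zero elements
  inserted, because the zero section is itself a homomorphism of symmetric racks. The remaining two
  use \<open>rop_decompose\<close>.\<close>

lemma sr_module_fiber: "sr_module X (fiber_module G)"
proof (rule sr_module.intro)
  let ?M = "fiber_module G"
  fix x assume x: "x \<in> carrier X"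
  show "comm_group (mgrp ?M x)"
    using comm_group_fiber x by (simp add: fiber_module_def)
  show "meta ?M x \<in> hom (mgrp ?M x) (mgrp ?M (\<rho> x))"
    using x by (auto intro!: homI simp: fiber_module_def fiber_def closed proj_simps add_ginv)
  fix y assume y: "y \<in> carrier X"
  have "mphi ?M x y \<in> hom (mgrp ?M x) (mgrp ?M (x \<triangleright> y))"
  proof (rule homI)
    fix a b assume "a \<in> carrier (mgrp ?M x)" "b \<in> carrier (mgrp ?M x)"
    \<comment> \<open>Additivity is the interchange law once \<open>zero y\<close> is read as
      \<open>zero y + zero y\<close>.\<close>
    then show "mphi ?M x y (a \<otimes>\<^bsub>mgrp ?M x\<^esub> b) = mphi ?M x y a \<otimes>\<^bsub>mgrp ?M (x \<triangleright> y)\<^esub> mphi ?M x y b"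
      using y add_rop[of a b "zero y" "zero y"]
      by (simp add: fiber_module_def fiber_def closed proj_simps zero_add)
  qed (use x y in \<open>auto simp: fiber_module_def fiber_def closed proj_simps\<close>)
  \<comment> \<open>Translation by the involute of \<open>zero y\<close> undoes translation by
    \<open>zero y\<close>.\<close>
  moreover have "bij_betw (mphi ?M x y) (carrier (mgrp ?M x)) (carrier (mgrp ?M (x \<triangleright> y)))"
    by (rule bij_betw_byWitness[where f' = "\<lambda>u. u \<triangleright>\<^bsub>E\<^esub> \<rho>\<^bsub>E\<^esub> (zero y)"])
      (use x y in \<open>auto simp: fiber_module_def fiber_def closed proj_simps
        E.rop_ginv_rop E.rop_rop_ginv rop_rop_ginv\<close>)
  ultimately show "mphi ?M x y \<in> iso (mgrp ?M x) (mgrp ?M (x \<triangleright> y))"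
    by (simp add: iso_def)
  show "mpsi ?M x y \<in> hom (mgrp ?M y) (mgrp ?M (x \<triangleright> y))"
  proof (rule homI)
    fix a b assume "a \<in> carrier (mgrp ?M y)" "b \<in> carrier (mgrp ?M y)"
    then show "mpsi ?M x y (a \<otimes>\<^bsub>mgrp ?M y\<^esub> b) = mpsi ?M x y a \<otimes>\<^bsub>mgrp ?M (x \<triangleright> y)\<^esub> mpsi ?M x y b"
      using x add_rop[of "zero x" "zero x" a b]
      by (simp add: fiber_module_def fiber_def closed proj_simps zero_add)
  qed (use x y in \<open>auto simp: fiber_module_def fiber_def closed proj_simps\<close>)
  {
    fix a assume a: "a \<in> carrier (mgrp ?M x)"
    show "meta ?M (x \<triangleright> y) (mphi ?M x y a) = mphi ?M (\<rho> x) y (meta ?M x a)"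
      using a y by (simp add: fiber_module_def fiber_def closed E.ginv_rop)
    show "mphi ?M (x \<triangleleft> y) y (mphi ?M x (\<rho> y) a) = a"
      using a y by (simp add: fiber_module_def fiber_def closed zero_ginv E.rop_ginv_rop)
  }
  {
    fix b assume b: "b \<in> carrier (mgrp ?M y)"
    show "mpsi ?M (\<rho> x) y b = meta ?M (x \<triangleright> y) (mpsi ?M x y b)"
      using b x by (simp add: fiber_module_def fiber_def closed E.ginv_rop zero_ginv)
    have bE: "b \<in> carrier E" "p b = y"
      using b by (simp_all add: fiber_module_def fiber_def)
    \<comment> \<open>The product of \<open>?u\<close> and \<open>b\<close> is computed twice:
      cancellation gives \<open>zero x\<close>, and \<open>rop_decompose\<close> gives a sum of two
      terms. So these terms are mutually inverse in the fibre over \<open>x\<close>.\<close>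
    let ?u = "zero x \<triangleright>\<^bsub>E\<^esub> \<rho>\<^bsub>E\<^esub> b"
    have "add (?u \<triangleright>\<^bsub>E\<^esub> zero y) (zero (x \<triangleright> \<rho> y) \<triangleright>\<^bsub>E\<^esub> b) = ?u \<triangleright>\<^bsub>E\<^esub> b"
      using rop_decompose[of ?u b] bE x y by (simp add: closed proj_simps)
    also have "\<dots> = zero x"
      using bE x by (simp add: E.rop_ginv_rop closed)
    finally have "inv\<^bsub>fiber G x\<^esub> (zero (x \<triangleright> \<rho> y) \<triangleright>\<^bsub>E\<^esub> b) = ?u \<triangleright>\<^bsub>E\<^esub> zero y"
      using bE x y comm_group_fiber[OF x, THEN comm_group.axioms(2)]
      by (intro group.inv_equality)
        (simp_all add: fiber_def closed proj_simps rop_ginv_rop)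
    then show "mphi ?M (x \<triangleleft> y) y (mpsi ?M x (\<rho> y) (meta ?M y b))
        = inv\<^bsub>mgrp ?M x\<^esub> (mpsi ?M (x \<triangleright> \<rho> y) y b)"
      by (simp add: fiber_module_def)
  }
  fix z assume z: "z \<in> carrier X"
  {
    fix a assume a: "a \<in> carrier (mgrp ?M x)"
    show "mphi ?M (x \<triangleright> y) z (mphi ?M x y a) = mphi ?M (x \<triangleright> z) (y \<triangleright> z) (mphi ?M x z a)"
      using a y z E.rop_distrib[of a "zero y" "zero z"]
      by (simp add: fiber_module_def fiber_def closed zero_rop)
  }
  {
    fix b assume b: "b \<in> carrier (mgrp ?M y)"
    show "mphi ?M (x \<triangleright> y) z (mpsi ?M x y b) = mpsi ?M (x \<triangleright> z) (y \<triangleright> z) (mphi ?M y z b)"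
      using b x z E.rop_distrib[of "zero x" b "zero z"]
      by (simp add: fiber_module_def fiber_def closed zero_rop)
  }
  fix a assume a: "a \<in> carrier (mgrp ?M z)"
  then have aE: "a \<in> carrier E" "p a = z"
    by (simp_all add: fiber_module_def fiber_def)
  \<comment> \<open>Self-distributivity applied to the product of two zeros yields a product of two
    elements, which \<open>rop_decompose\<close> then splits into the required sum.\<close>
  have "zero (x \<triangleright> y) \<triangleright>\<^bsub>E\<^esub> a = (zero x \<triangleright>\<^bsub>E\<^esub> a) \<triangleright>\<^bsub>E\<^esub> (zero y \<triangleright>\<^bsub>E\<^esub> a)"
    using aE x y E.rop_distrib[of "zero x" "zero y" a] by (simp add: closed zero_rop)
  also have "\<dots> = add ((zero x \<triangleright>\<^bsub>E\<^esub> a) \<triangleright>\<^bsub>E\<^esub> zero (y \<triangleright> z)) (zero (x \<triangleright> z) \<triangleright>\<^bsub>E\<^esub> (zero y \<triangleright>\<^bsub>E\<^esub> a))"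
    using aE x y rop_decompose[of "zero x \<triangleright>\<^bsub>E\<^esub> a" "zero y \<triangleright>\<^bsub>E\<^esub> a"]
    by (simp add: closed proj_simps)
  finally show "mpsi ?M (x \<triangleright> y) z a = mphi ?M (x \<triangleright> z) (y \<triangleright> z) (mpsi ?M x z a)
      \<otimes>\<^bsub>mgrp ?M ((x \<triangleright> y) \<triangleright> z)\<^esub> mpsi ?M (x \<triangleright> z) (y \<triangleright> z) (mpsi ?M y z a)"
    by (simp add: fiber_module_def fiber_def)
next
  fix x a assume "x \<in> carrier X" "a \<in> carrier (mgrp (fiber_module G) x)"
  then show "meta (fiber_module G) (\<rho> x) (meta (fiber_module G) x a) = a"
    by (simp add: fiber_module_def fiber_def E.ginv_ginv)
qed

lemma ab_group_hom_Ident: "Ident (AbSR X) G \<in> ab_group_hom G G"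
  by (rule ab_group_homI, rule slice_homI) (auto simp: AbSR_def closed)

lemma ab_group_hom_Comp:
  assumes f: "f \<in> ab_group_hom G H" and g: "g \<in> ab_group_hom H K"
  shows "Comp (AbSR X) G H K g f \<in> ab_group_hom G K"
proof -
  note fD = slice_homD[OF ab_group_homD(1)[OF f]] ab_group_homD(2)[OF f]
  note gD = slice_homD[OF ab_group_homD(1)[OF g]] ab_group_homD(2)[OF g]
  show ?thesis
    by (rule ab_group_homI, rule slice_homI) (auto simp: AbSR_def closed compose_eq fD gD)
qed

end

lemma group_object_over_rackI:
  "\<lbrakk>symmetric_rack X; ab_group_object X G\<rbrakk> \<Longrightarrow> group_object_over_rack X G"
  by (simp add: group_object_over_rack_def group_object_over_rack_axioms_def)

section \<open>The category of abelian group objects\<close>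

lemma category_AbSR:
  fixes X :: "'x symm_rack"
  assumes X: "symmetric_rack X"
  shows "category (AbSR X :: (('e, 'x) group_object, 'e \<Rightarrow> 'e) category)"
proof
  fix G H :: "('e, 'x) group_object"
  assume "G \<in> Obj (AbSR X)"
  then interpret G: group_object_over_rack X G
    using X by (simp add: AbSR_def group_object_over_rackI)
  show "Ident (AbSR X) G \<in> Arr (AbSR X) G G"
    using G.ab_group_hom_Ident by (simp add: AbSR_def)
  fix f assume "f \<in> Arr (AbSR X) G H"
  then have f: "f \<in> ab_group_hom G H" by (simp add: AbSR_def)
  note fD = slice_homD[OF ab_group_homD(1)[OF f]]
  show "Comp (AbSR X) G H H (Ident (AbSR X) H) f = f"
    by (rule extensionalityI[of _ "carrier (total_rack G)"]) (auto simp: AbSR_def compose_eq fD)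
  show "Comp (AbSR X) G G H f (Ident (AbSR X) G) = f"
    by (rule extensionalityI[of _ "carrier (total_rack G)"]) (auto simp: AbSR_def compose_eq fD)
  fix K :: "('e, 'x) group_object" and g
  assume "g \<in> Arr (AbSR X) H K"
  then have g: "g \<in> ab_group_hom H K" by (simp add: AbSR_def)
  show "Comp (AbSR X) G H K g f \<in> Arr (AbSR X) G K"
    using G.ab_group_hom_Comp[OF f g] by (simp add: AbSR_def)
  fix L :: "('e, 'x) group_object" and h
  assume "h \<in> Arr (AbSR X) K L"
  show "Comp (AbSR X) G K L h (Comp (AbSR X) G H K g f)
      = Comp (AbSR X) G H L (Comp (AbSR X) H K L h g) f"
    by (rule extensionalityI[of _ "carrier (total_rack G)"]) (auto simp: AbSR_def compose_eq fD)
qed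


section \<open>From modules to abelian group objects: the total space\<close>

section \<open>The functor of total spaces\<close>

text \<open>Elements \<open>(x, a)\<close> of a disjoint union are encoded in \<open>'e\<close>; the code is required to be
  surjective so that every \<open>u :: 'e\<close> is \<open>enc (base u, coord u)\<close>.\<close>

locale pairing =
  fixes enc :: "'x \<times> 'a \<Rightarrow> 'e"
  assumes bij_enc: "bij enc"
begin

definition base :: "'e \<Rightarrow> 'x"
  where "base u = fst (inv_into UNIV enc u)"

definition coord :: "'e \<Rightarrow> 'a"
  where "coord u = snd (inv_into UNIV enc u)"

lemma base_enc [simp]: "base (enc (x, a)) = x"
  and coord_enc [simp]: "coord (enc (x, a)) = a"
  using bij_enc by (simp_all add: base_def coord_def bij_is_inj)

lemma enc_base_coord [simp]: "enc (base u, coord u) = u"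
  using bij_enc by (simp add: base_def coord_def bij_is_surj surj_f_inv_f)

lemma enc_eq_iff [simp]: "enc q = enc q' \<longleftrightarrow> q = q'"
  using bij_enc by (simp add: bij_is_inj inj_eq)

definition total_carrier :: "'x symm_rack \<Rightarrow> ('x, 'a) sr_module \<Rightarrow> 'e set"
  where "total_carrier X M = {u. base u \<in> carrier X \<and> coord u \<in> carrier (mgrp M (base u))}"

text \<open>The maps required to be morphisms are restricted to their domains, as
  \<open>slice_hom\<close> and \<open>sr_hom\<close> ask for extensional functions; the rack
  operation and involution are left as bare formulas.\<close>

definition total_object :: "'x symm_rack \<Rightarrow> ('x, 'a) sr_module \<Rightarrow> ('e, 'x) group_object"
  where "total_object X M =
    \<lparr>total_rack =
       \<lparr>carrier = total_carrier X M,
        rop = (\<lambda>u v. enc (base u \<triangleright>\<^bsub>X\<^esub> base v,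
                          module_act X M (base u) (base v) (coord u) (coord v))),
        ginv = (\<lambda>u. enc (\<rho>\<^bsub>X\<^esub> (base u), meta M (base u) (coord u)))\<rparr>,
     proj = (\<lambda>u \<in> total_carrier X M. base u),
     gmult = (\<lambda>(u, v) \<in> {(u, v). u \<in> total_carrier X M \<and> v \<in> total_carrier X M \<and> base u = base v}.
       enc (base u, coord u \<otimes>\<^bsub>mgrp M (base u)\<^esub> coord v)),
     gunit = (\<lambda>x \<in> carrier X. enc (x, \<one>\<^bsub>mgrp M x\<^esub>)),
     ginverse = (\<lambda>u \<in> total_carrier X M. enc (base u, inv\<^bsub>mgrp M (base u)\<^esub> (coord u)))\<rparr>"

definition total_arr ::
  "'x symm_rack \<Rightarrow> ('x, 'a) sr_module \<Rightarrow> ('x \<Rightarrow> 'a \<Rightarrow> 'a) \<Rightarrow> 'e \<Rightarrow> 'e"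
  where "total_arr X M f = (\<lambda>u \<in> total_carrier X M. enc (base u, f (base u) (coord u)))"

definition total_functor ::
  "'x symm_rack \<Rightarrow> (('x, 'a) sr_module, 'x \<Rightarrow> 'a \<Rightarrow> 'a, ('e, 'x) group_object, 'e \<Rightarrow> 'e) cat_functor"
  where "total_functor X = \<lparr>fobj = total_object X, farr = (\<lambda>M N. total_arr X M)\<rparr>"

definition unit_map :: "'x symm_rack \<Rightarrow> ('x, 'a) sr_module \<Rightarrow> 'x \<Rightarrow> 'a \<Rightarrow> 'e"
  where "unit_map X M = (\<lambda>x \<in> carrier X. \<lambda>a \<in> carrier (mgrp M x). enc (x, a))"

lemma total_object_simps:
  "carrier (total_rack (total_object X M)) = total_carrier X M"
  "u \<triangleright>\<^bsub>total_rack (total_object X M)\<^esub> v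
    = enc (base u \<triangleright>\<^bsub>X\<^esub> base v, module_act X M (base u) (base v) (coord u) (coord v))"
  "\<rho>\<^bsub>total_rack (total_object X M)\<^esub> u = enc (\<rho>\<^bsub>X\<^esub> (base u), meta M (base u) (coord u))"
  "u \<in> total_carrier X M \<Longrightarrow> proj (total_object X M) u = base u"
  "\<lbrakk>u \<in> total_carrier X M; v \<in> total_carrier X M; base u = base v\<rbrakk>
    \<Longrightarrow> gmult (total_object X M) (u, v) = enc (base u, coord u \<otimes>\<^bsub>mgrp M (base u)\<^esub> coord v)"
  "x \<in> carrier X \<Longrightarrow> gunit (total_object X M) x = enc (x, \<one>\<^bsub>mgrp M x\<^esub>)"
  "u \<in> total_carrier X M
    \<Longrightarrow> ginverse (total_object X M) u = enc (base u, inv\<^bsub>mgrp M (base u)\<^esub> (coord u))"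
  by (simp_all add: total_object_def)

lemma mem_total_carrier:
  "u \<in> total_carrier X M \<longleftrightarrow> base u \<in> carrier X \<and> coord u \<in> carrier (mgrp M (base u))"
  by (simp add: total_carrier_def)

end

locale module_total = module_over_rack X M + pairing enc
  for X :: "'x symm_rack" (structure) and M :: "('x, 'a) sr_module" and enc :: "'x \<times> 'a \<Rightarrow> 'e"
begin

abbreviation "T \<equiv> total_object X M"

lemma total_ext:
  "gmult T \<in> extensional (carrier (total_rack (slice_prod T T)))"
  "gunit T \<in> extensional (carrier X)"
  "ginverse T \<in> extensional (total_carrier X M)"
  "proj T \<in> extensional (total_carrier X M)"
  by (auto simp: total_object_def extensional_def slice_prod_def slice_prod_carrier_def)

text \<open>Each law splits into base and coordinate: the base part is a law of \<open>X\<close>,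
  the coordinate part a law of \<open>act\<close> or of \<open>\<eta>\<close>.\<close>

lemma symmetric_rack_total: "symmetric_rack (total_rack T)"
proof (rule symmetric_rackI)
  fix u v w
  assume "u \<in> carrier (total_rack T)" "v \<in> carrier (total_rack T)" "w \<in> carrier (total_rack T)"
  then show "(u \<triangleright>\<^bsub>total_rack T\<^esub> v) \<triangleright>\<^bsub>total_rack T\<^esub> w
      = (u \<triangleright>\<^bsub>total_rack T\<^esub> w) \<triangleright>\<^bsub>total_rack T\<^esub> (v \<triangleright>\<^bsub>total_rack T\<^esub> w)"
    using rop_distrib[of "base u" "base v" "base w"]
      act_distrib[of "base u" "base v" "base w" "coord u" "coord v" "coord w"]
    by (simp add: total_object_simps mem_total_carrier)
qed (simp_all add: total_object_simps mem_total_carrier closed act_closed act_eta_act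
      eta_eta eta_act ginv_ginv ginv_rop rop_ginv_rop)

text \<open>Compatibility with the rack operation is \<open>act_mult\<close> for addition,
  \<open>act_one_right\<close> with \<open>phi_one\<close> for the zero section and
  \<open>act_inv\<close> for negation. The group laws hold because each takes place in a single
  group \<open>A (base u)\<close>.\<close>

lemma ab_group_object_total: "ab_group_object X T"
proof (rule ab_group_object.intro)
  show "slice_object X T"
    by (auto simp: slice_object_def sr_hom_def symmetric_rack_total total_ext total_object_simps
        mem_total_carrier closed act_closed PiE_def)
  show "gmult T \<in> slice_hom (slice_prod T T) T"
    by (rule slice_homI)
      (auto simp: total_ext slice_prod_simps total_object_simps mem_total_carrier closed act_closed
        act_mult hom_mult[OF eta_hom])
  show "gunit T \<in> slice_hom (slice_terminal X) T"
    by (rule slice_homI)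
      (auto simp: slice_terminal_def total_ext total_object_simps mem_total_carrier closed
        act_one_right phi_one eta_one)
  show "ginverse T \<in> slice_hom T T"
    by (rule slice_homI)
      (auto simp: total_ext total_object_simps mem_total_carrier closed act_closed
        act_inv eta_inv)
next
  fix u v w assume "((u, v), w) \<in> carrier (total_rack (slice_prod (slice_prod T T) T))"
  then show "gmult T (gmult T (u, v), w) = gmult T (u, gmult T (v, w))"
    by (auto simp: slice_prod_simps total_object_simps mem_total_carrier closed
        monoid.m_assoc[OF group.is_monoid[OF grp]])
next
  fix u v assume "(u, v) \<in> carrier (total_rack (slice_prod T T))"
  then show "gmult T (u, v) = gmult T (v, u)"
    using comm_monoid.m_comm[OF comm_group.axioms(1)[OF comm_grp], of "base u" "coord u" "coord v"]
    by (auto simp: slice_prod_simps total_object_simps mem_total_carrier)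
next
  fix u assume "u \<in> carrier (total_rack T)"
  then show "gmult T (gunit T (proj T u), u) = u" "gmult T (ginverse T u, u) = gunit T (proj T u)"
    by (simp_all add: total_object_simps mem_total_carrier closed
        monoid.l_one[OF group.is_monoid[OF grp]] group.l_inv[OF grp])
qed

text \<open>An additive family commuting with \<open>\<phi>\<close> and \<open>\<psi>\<close>
  commutes with their sum, so the induced map of total spaces respects the operation.\<close>

lemma sr_module_hom_act:
  assumes f: "f \<in> sr_module_hom X M N"
    and x: "x \<in> carrier X" "y \<in> carrier X" and a: "a \<in> carrier (A x)" "b \<in> carrier (A y)"
  shows "f (x \<triangleright> y) (act x y a b) = module_act X N x y (f x a) (f y b)"
  using x a by (simp add: module_act_def hom_mult[OF sr_module_homD(3)[OF f]] closed
      sr_module_homD(4,5)[OF f])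

lemma total_arr_hom:
  assumes f: "f \<in> sr_module_hom X M N"
  shows "total_arr X M f \<in> ab_group_hom T (total_object X N)"
proof (rule ab_group_homI, rule slice_homI)
qed (auto simp: total_arr_def total_object_simps mem_total_carrier closed act_closed
    sr_module_hom_closed[OF f] sr_module_hom_act[OF f] sr_module_homD(6)[OF f]
    hom_mult[OF sr_module_homD(3)[OF f]])

text \<open>The maps of the fibre module of \<open>T\<close> multiply by a zero element on one side;
  by \<open>act_one_right\<close> and \<open>act_one_left\<close> they act on coordinates as
  \<open>\<phi>\<close> and \<open>\<psi>\<close>.\<close>

lemma unit_map_hom: "unit_map X M \<in> sr_module_hom X M (fiber_module T)"
  by (rule sr_module_homI)
    (auto intro!: homI simp: unit_map_def fiber_module_def fiber_def total_object_simps
      mem_total_carrier closed act_one_left act_one_right)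

text \<open>On the fibre over \<open>x\<close> the base point is constant, so forgetting it by
  \<open>coord\<close> is inverse to the encoding.\<close>

lemma unit_map_bij:
  assumes "x \<in> carrier X"
  shows "bij_betw (unit_map X M x) (carrier (A x)) (carrier (mgrp (fiber_module T) x))"
  by (rule bij_betw_byWitness[where f' = coord])
    (use assms in \<open>auto simp: unit_map_def fiber_module_def fiber_def total_object_simps
      mem_total_carrier\<close>)

end


lemma (in pairing) module_totalI:
  "\<lbrakk>symmetric_rack X; sr_module X M\<rbrakk> \<Longrightarrow> module_total X M enc"
  by (simp add: module_total_def pairing_axioms module_over_rackI)

lemma (in pairing) cat_functor_total:
  assumes X: "symmetric_rack X"
  shows "cat_functor (SRMod X) (AbSR X) (total_functor X)"
proof
  fix M N :: "('x, 'a) sr_module"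
  assume "M \<in> Obj (SRMod X)"
  then interpret M: module_total X M enc
    using X by (simp add: SRMod_def module_totalI)
  show "fobj (total_functor X) M \<in> Obj (AbSR X)"
    using M.ab_group_object_total by (simp add: total_functor_def AbSR_def)
  show "farr (total_functor X) M M (Ident (SRMod X) M) = Ident (AbSR X) (fobj (total_functor X) M)"
    by (auto simp: fun_eq_iff total_functor_def AbSR_def SRMod_def total_arr_def
        total_object_simps mem_total_carrier)
  fix f assume "f \<in> Arr (SRMod X) M N"
  then have f: "f \<in> sr_module_hom X M N" by (simp add: SRMod_def)
  show "farr (total_functor X) M N f
      \<in> Arr (AbSR X) (fobj (total_functor X) M) (fobj (total_functor X) N)"
    using M.total_arr_hom[OF f] by (simp add: total_functor_def AbSR_def)
  fix L :: "('x, 'a) sr_module" and g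
  assume "g \<in> Arr (SRMod X) N L"
  show "farr (total_functor X) M L (Comp (SRMod X) M N L g f)
      = Comp (AbSR X) (fobj (total_functor X) M) (fobj (total_functor X) N)
          (fobj (total_functor X) L) (farr (total_functor X) N L g) (farr (total_functor X) M N f)"
    using sr_module_hom_closed[OF f]
    by (auto simp: fun_eq_iff total_functor_def AbSR_def SRMod_def total_arr_def compose_def
        total_object_simps mem_total_carrier)
qed

section \<open>Functoriality of the fibres\<close>

section \<open>The functor of fibres\<close>

definition fiber_arr ::
  "'x symm_rack \<Rightarrow> ('e, 'x) group_object \<Rightarrow> ('e \<Rightarrow> 'f) \<Rightarrow> 'x \<Rightarrow> 'e \<Rightarrow> 'f"
  where "fiber_arr X G f = (\<lambda>x \<in> carrier X. restrict f (carrier (fiber G x)))"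

definition fiber_functor ::
  "'x symm_rack \<Rightarrow> (('e, 'x) group_object, 'e \<Rightarrow> 'e, ('x, 'e) sr_module, 'x \<Rightarrow> 'e \<Rightarrow> 'e) cat_functor"
  where "fiber_functor X = \<lparr>fobj = fiber_module, farr = (\<lambda>G H. fiber_arr X G)\<rparr>"

context group_object_over_rack
begin

lemma ab_group_hom_fiber:
  assumes "f \<in> ab_group_hom G H" and "x \<in> carrier X"
  shows "f \<in> hom (fiber G x) (fiber H x)"
  using slice_homD[OF ab_group_homD(1)[OF assms(1)]] ab_group_homD(2)[OF assms(1)]
  by (auto intro!: homI simp: fiber_def)

text \<open>Morphisms are only required to commute with addition. On each fibre this makes them
  group homomorphisms, hence zeros are preserved; the maps \<open>\<phi>\<close> and
  \<open>\<psi>\<close> of a fibre module are built from these zeros.\<close>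

lemma ab_group_hom_zero:
  assumes H: "ab_group_object X H" and f: "f \<in> ab_group_hom G H" and x: "x \<in> carrier X"
  shows "f (gunit G x) = gunit H x"
proof -
  interpret H: group_object_over_rack X H
    by (rule group_object_over_rackI[OF symmetric_rack_axioms H])
  show ?thesis
    using hom_one[OF ab_group_hom_fiber[OF f x]] comm_group_fiber[OF x] H.comm_group_fiber[OF x]
    by (simp add: comm_group_def fiber_def)
qed

lemma fiber_arr_hom:
  assumes H: "ab_group_object X H" and f: "f \<in> ab_group_hom G H"
  shows "fiber_arr X G f \<in> sr_module_hom X (fiber_module G) (fiber_module H)"
proof (rule sr_module_homI)
  fix x assume x: "x \<in> carrier X"
  show "fiber_arr X G f x \<in> hom (mgrp (fiber_module G) x) (mgrp (fiber_module H) x)"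
  proof -
    interpret F: comm_group "fiber G x" by (rule comm_group_fiber[OF x])
    note h = ab_group_hom_fiber[OF f x]
    show ?thesis
      by (rule homI)
        (simp_all add: fiber_arr_def fiber_module_def x hom_mult[OF h] hom_in_carrier[OF h])
  qed
qed (use slice_homD[OF ab_group_homD(1)[OF f]] ab_group_hom_zero[OF H f] in
    \<open>auto simp: fiber_arr_def fiber_module_def fiber_def closed proj_simps\<close>)

end

lemma cat_functor_fiber:
  fixes X :: "'x symm_rack"
  assumes X: "symmetric_rack X"
  shows "cat_functor (AbSR X :: (('e, 'x) group_object, 'e \<Rightarrow> 'e) category) (SRMod X) (fiber_functor X)"
proof
  fix G H :: "('e, 'x) group_object"
  assume "G \<in> Obj (AbSR X)"
  then interpret G: group_object_over_rack X G
    using X by (simp add: AbSR_def group_object_over_rackI)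
  show "fobj (fiber_functor X) G \<in> Obj (SRMod X)"
    using G.sr_module_fiber by (simp add: fiber_functor_def SRMod_def)
  show "farr (fiber_functor X) G G (Ident (AbSR X) G) = Ident (SRMod X) (fobj (fiber_functor X) G)"
    by (auto simp: fun_eq_iff fiber_functor_def AbSR_def SRMod_def fiber_arr_def fiber_module_def
        fiber_def)
  fix f assume "H \<in> Obj (AbSR X)" and "f \<in> Arr (AbSR X) G H"
  then have H: "ab_group_object X H" and f: "f \<in> ab_group_hom G H" by (simp_all add: AbSR_def)
  show "farr (fiber_functor X) G H f
      \<in> Arr (SRMod X) (fobj (fiber_functor X) G) (fobj (fiber_functor X) H)"
    using G.fiber_arr_hom[OF H f] by (simp add: fiber_functor_def SRMod_def)
  fix K :: "('e, 'x) group_object" and g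
  assume "g \<in> Arr (AbSR X) H K"
  show "farr (fiber_functor X) G K (Comp (AbSR X) G H K g f)
      = Comp (SRMod X) (fobj (fiber_functor X) G) (fobj (fiber_functor X) H)
          (fobj (fiber_functor X) K) (farr (fiber_functor X) H K g) (farr (fiber_functor X) G H f)"
    using slice_homD[OF ab_group_homD(1)[OF f]]
    by (auto simp: fun_eq_iff fiber_functor_def AbSR_def SRMod_def fiber_arr_def fiber_module_def
        fiber_def compose_def)
qed

section \<open>Bijective morphisms are isomorphisms\<close>

section \<open>Isomorphisms\<close>

text \<open>As usual for algebraic structures, the inverse of a bijective morphism respects all
  operations, so bijectivity on each group suffices.\<close>

lemma isomorphism_SRMod:
  assumes X: "symmetric_rack X" and M: "sr_module X M" and N: "sr_module X N"
    and f: "f \<in> sr_module_hom X M N"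
    and bij: "\<And>x. x \<in> carrier X \<Longrightarrow> bij_betw (f x) (carrier (mgrp M x)) (carrier (mgrp N x))"
  shows "isomorphism (SRMod X) M N f"
proof -
  interpret M: module_over_rack X M by (rule module_over_rackI[OF X M])
  interpret N: module_over_rack X N by (rule module_over_rackI[OF X N])
  note fD = sr_module_homD[OF f]
  define g where "g = (\<lambda>x \<in> carrier X. \<lambda>b \<in> carrier (mgrp N x).
    inv_into (carrier (mgrp M x)) (f x) b)"
  have gf: "g x (f x a) = a" if "x \<in> carrier X" "a \<in> carrier (mgrp M x)" for x a
    using that bij_betw_inv_into_left[OF bij] sr_module_hom_closed[OF f] by (simp add: g_def)
  \<comment> \<open>An identity for \<open>g\<close> is verified by applying \<open>f\<close>: it
    suffices that \<open>f\<close> sends the claimed value to the argument, and there the morphism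
    laws of \<open>f\<close> apply.\<close>
  have g_eqI: "g x b = a" if "x \<in> carrier X" "a \<in> carrier (mgrp M x)" "f x a = b" for x a b
    using gf that by blast
  have gcl: "g x b \<in> carrier (mgrp M x)" if "x \<in> carrier X" "b \<in> carrier (mgrp N x)" for x b
    using that bij_betw_inv_into[OF bij, THEN bij_betwE] by (simp add: g_def)
  have fg: "f x (g x b) = b" if "x \<in> carrier X" "b \<in> carrier (mgrp N x)" for x b
    using that bij_betw_inv_into_right[OF bij] by (simp add: g_def)
  have "g \<in> sr_module_hom X N M"
  proof (rule sr_module_homI)
    fix x assume x: "x \<in> carrier X"
    show "g x \<in> hom (mgrp N x) (mgrp M x)"
      by (rule homI) (simp_all add: x gcl g_eqI fg M.closed hom_mult[OF fD(3)])
    fix a assume a: "a \<in> carrier (mgrp N x)"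
    show "meta M x (g x a) = g (\<rho>\<^bsub>X\<^esub> x) (meta N x a)"
      by (rule g_eqI[symmetric]) (simp_all add: x a gcl M.closed fD(6)[symmetric] fg)
    fix y assume y: "y \<in> carrier X"
    show "mphi M x y (g x a) = g (x \<triangleright>\<^bsub>X\<^esub> y) (mphi N x y a)"
      by (rule g_eqI[symmetric]) (simp_all add: x y a gcl M.closed fD(4)[symmetric] fg)
  next
    fix x y b assume x: "x \<in> carrier X" "y \<in> carrier X" and b: "b \<in> carrier (mgrp N y)"
    show "mpsi M x y (g y b) = g (x \<triangleright>\<^bsub>X\<^esub> y) (mpsi N x y b)"
      by (rule g_eqI[symmetric]) (simp_all add: x b gcl M.closed fD(5)[symmetric] fg)
  qed (simp_all add: g_def)
  moreover have "Comp (SRMod X) M N M g f = Ident (SRMod X) M"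
    by (auto simp: fun_eq_iff SRMod_def compose_def gf)
  moreover have "Comp (SRMod X) N M N f g = Ident (SRMod X) N"
    by (auto simp: fun_eq_iff SRMod_def compose_def fg)
  ultimately show ?thesis
    using f by (auto simp: isomorphism_def SRMod_def)
qed

lemma isomorphism_AbSR:
  assumes X: "symmetric_rack X" and G: "ab_group_object X G" and H: "ab_group_object X H"
    and f: "f \<in> ab_group_hom G H"
    and bij: "bij_betw f (carrier (total_rack G)) (carrier (total_rack H))"
  shows "isomorphism (AbSR X) G H f"
proof -
  interpret G: group_object_over_rack X G by (rule group_object_over_rackI[OF X G])
  interpret H: group_object_over_rack X H by (rule group_object_over_rackI[OF X H])
  note fD = slice_homD[OF ab_group_homD(1)[OF f]] ab_group_homD(2)[OF f]
  define g where "g = (\<lambda>v \<in> carrier (total_rack H). inv_into (carrier (total_rack G)) f v)"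
  have gf: "g (f u) = u" if "u \<in> carrier (total_rack G)" for u
    using that bij_betw_inv_into_left[OF bij] fD(2) by (simp add: g_def)
  have g_eqI: "g v = u" if "u \<in> carrier (total_rack G)" "f u = v" for u v
    using gf that by blast
  have gcl: "g v \<in> carrier (total_rack G)" if "v \<in> carrier (total_rack H)" for v
    using that bij_betw_inv_into[OF bij, THEN bij_betwE] by (simp add: g_def)
  have fg: "f (g v) = v" if "v \<in> carrier (total_rack H)" for v
    using that bij_betw_inv_into_right[OF bij] by (simp add: g_def)
  \<comment> \<open>Elements of one fibre thus go to one fibre under \<open>g\<close>, so their
    images can be added and the additivity of \<open>f\<close> can be used.\<close>
  have gp: "proj G (g v) = proj H v" if "v \<in> carrier (total_rack H)" for v
    using fD(3)[OF gcl[OF that]] fg[OF that] by simp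
  have "g \<in> ab_group_hom H G"
    by (rule ab_group_homI, rule slice_homI)
      (auto simp: gcl gp g_eqI fg fD(4,5,6) G.closed, simp add: g_def)
  moreover have "Comp (AbSR X) G H G g f = Ident (AbSR X) G"
    by (auto simp: fun_eq_iff AbSR_def compose_def gf)
  moreover have "Comp (AbSR X) H G H f g = Ident (AbSR X) H"
    by (auto simp: fun_eq_iff AbSR_def compose_def fg)
  ultimately show ?thesis
    using f by (auto simp: isomorphism_def AbSR_def)
qed

section \<open>Unit, counit and the equivalence\<close>

section \<open>The equivalence\<close>

text \<open>Codes lie in the element type of the modules themselves, so that both functors keep this
  type and can be composed in either order.\<close>

locale self_pairing = pairing enc for enc :: "'x \<times> 'u \<Rightarrow> 'u"
begin

text \<open>Invertibility comes from fibrewise bijectivity; in the naturality square both paths send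
  \<open>a\<close> over \<open>x\<close> to \<open>enc (x, f x a)\<close>.\<close>

lemma natural_isomorphism_unit:
  assumes X: "symmetric_rack X"
  shows "natural_isomorphism (SRMod X) (SRMod X) id_functor
    (comp_functor (fiber_functor X) (total_functor X)) (unit_map X)"
  unfolding natural_isomorphism_def
proof (intro conjI ballI)
  fix M :: "('x, 'u) sr_module"
  assume "M \<in> Obj (SRMod X)"
  then have M: "sr_module X M" by (simp add: SRMod_def)
  then interpret M: module_total X M enc
    by (rule module_totalI[OF X])
  interpret T: group_object_over_rack X "total_object X M"
    by (rule group_object_over_rackI[OF X M.ab_group_object_total])
  show "isomorphism (SRMod X) (fobj id_functor M)
      (fobj (comp_functor (fiber_functor X) (total_functor X)) M) (unit_map X M)"
    using isomorphism_SRMod[OF X M T.sr_module_fiber M.unit_map_hom M.unit_map_bij]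
    by (simp add: id_functor_def comp_functor_def fiber_functor_def total_functor_def)
  fix N :: "('x, 'u) sr_module" and f
  assume "f \<in> Arr (SRMod X) M N"
  then have f: "f \<in> sr_module_hom X M N" by (simp add: SRMod_def)
  show "Comp (SRMod X) (fobj id_functor M)
        (fobj (comp_functor (fiber_functor X) (total_functor X)) M)
        (fobj (comp_functor (fiber_functor X) (total_functor X)) N)
        (farr (comp_functor (fiber_functor X) (total_functor X)) M N f) (unit_map X M)
      = Comp (SRMod X) (fobj id_functor M) (fobj id_functor N)
        (fobj (comp_functor (fiber_functor X) (total_functor X)) N)
        (unit_map X N) (farr id_functor M N f)"
    using sr_module_hom_closed[OF f]
    by (auto simp: fun_eq_iff id_functor_def comp_functor_def fiber_functor_def total_functor_def
        SRMod_def compose_def unit_map_def fiber_arr_def total_arr_def fiber_def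
        total_object_simps mem_total_carrier)
qed

definition counit_map :: "'x symm_rack \<Rightarrow> ('u, 'x) group_object \<Rightarrow> 'u \<Rightarrow> 'u"
  where "counit_map X G = restrict coord (total_carrier X (fiber_module G))"

text \<open>The total space of the fibre module consists of the codes of pairs
  \<open>(proj G v, v)\<close>; that the base lies in \<open>carrier X\<close> follows since the
  projection lands there.\<close>

lemma mem_total_fiber:
  assumes "symmetric_rack X" and "ab_group_object X G"
  shows "u \<in> total_carrier X (fiber_module G)
    \<longleftrightarrow> coord u \<in> carrier (total_rack G) \<and> proj G (coord u) = base u"
  using group_object_over_rack.proj_closed[OF group_object_over_rackI[OF assms], of "coord u"]
  by (auto simp: mem_total_carrier fiber_module_def fiber_def)

lemma counit_map_hom:
  assumes X: "symmetric_rack X" and G: "ab_group_object X G"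
  shows "counit_map X G \<in> ab_group_hom (total_object X (fiber_module G)) G"
proof -
  interpret G: group_object_over_rack X G by (rule group_object_over_rackI[OF X G])
  interpret M: module_total X "fiber_module G" enc by (rule module_totalI[OF X G.sr_module_fiber])
  note mem = mem_total_fiber[OF X G]
  \<comment> \<open>The action formed from the fibre maps reassembles the original product; this is
    \<open>rop_decompose\<close> read in the fibre module.\<close>
  have act: "module_act X (fiber_module G) x y a b = a \<triangleright>\<^bsub>total_rack G\<^esub> b"
    if "a \<in> carrier (total_rack G)" "proj G a = x" "b \<in> carrier (total_rack G)" "proj G b = y"
    for x y a b
    using that G.rop_decompose[of a b] by (simp add: module_act_def fiber_module_def fiber_def)
  have meta: "meta (fiber_module G) x a = \<rho>\<^bsub>total_rack G\<^esub> a" for x a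
    by (simp add: fiber_module_def)
  have mult: "a \<otimes>\<^bsub>mgrp (fiber_module G) x\<^esub> b = gmult G (a, b)" for a b x
    by (simp add: fiber_module_def fiber_def)
  show ?thesis
    by (rule ab_group_homI, rule slice_homI)
      (auto simp: counit_map_def total_object_simps mem act meta mult G.closed G.proj_simps)
qed

lemma counit_map_bij:
  assumes X: "symmetric_rack X" and G: "ab_group_object X G"
  shows "bij_betw (counit_map X G) (carrier (total_rack (total_object X (fiber_module G))))
    (carrier (total_rack G))"
  \<comment> \<open>The inverse attaches to each element its own base point.\<close>
  by (rule bij_betw_byWitness[where f' = "\<lambda>u. enc (proj G u, u)"])
    (auto simp: counit_map_def total_object_simps mem_total_fiber[OF X G])

lemma natural_isomorphism_counit:
  assumes X: "symmetric_rack X"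
  shows "natural_isomorphism (AbSR X) (AbSR X) (comp_functor (total_functor X) (fiber_functor X))
    id_functor (counit_map X)"
  unfolding natural_isomorphism_def
proof (intro conjI ballI)
  fix G :: "('u, 'x) group_object"
  assume "G \<in> Obj (AbSR X)"
  then have G: "ab_group_object X G" by (simp add: AbSR_def)
  then interpret G: group_object_over_rack X G by (rule group_object_over_rackI[OF X])
  interpret M: module_total X "fiber_module G" enc by (rule module_totalI[OF X G.sr_module_fiber])
  show "isomorphism (AbSR X) (fobj (comp_functor (total_functor X) (fiber_functor X)) G)
      (fobj id_functor G) (counit_map X G)"
    using isomorphism_AbSR[OF X M.ab_group_object_total G counit_map_hom[OF X G]
        counit_map_bij[OF X G]]
    by (simp add: id_functor_def comp_functor_def fiber_functor_def total_functor_def)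
  fix H :: "('u, 'x) group_object" and f
  assume "H \<in> Obj (AbSR X)" and "f \<in> Arr (AbSR X) G H"
  then have H: "ab_group_object X H" and f: "f \<in> ab_group_hom G H" by (simp_all add: AbSR_def)
  note fD = slice_homD[OF ab_group_homD(1)[OF f]]
  \<comment> \<open>The family \<open>fiber_arr X G f\<close> is evaluated at \<open>base u\<close>
    and is restricted to \<open>carrier X\<close>, so this membership is what lets the restriction
    be removed.\<close>
  have base: "base u \<in> carrier X"
    if "coord u \<in> carrier (total_rack G)" "proj G (coord u) = base u" for u
    using that G.proj_closed[of "coord u"] by simp
  show "Comp (AbSR X) (fobj (comp_functor (total_functor X) (fiber_functor X)) G)
        (fobj id_functor G) (fobj id_functor H) (farr id_functor G H f) (counit_map X G)
      = Comp (AbSR X) (fobj (comp_functor (total_functor X) (fiber_functor X)) G)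
        (fobj (comp_functor (total_functor X) (fiber_functor X)) H) (fobj id_functor H)
        (counit_map X H) (farr (comp_functor (total_functor X) (fiber_functor X)) G H f)"
    by (auto simp: fun_eq_iff id_functor_def comp_functor_def fiber_functor_def total_functor_def
        AbSR_def compose_def counit_map_def fiber_arr_def total_arr_def total_object_simps
        mem_total_fiber[OF X G] mem_total_fiber[OF X H] fD base fiber_def[of G])
qed

lemma equivalent_SRMod_AbSR:
  fixes X :: "'x symm_rack"
  assumes X: "symmetric_rack X"
  shows "equivalent_categories
    (SRMod X :: (('x, 'u) sr_module, 'x \<Rightarrow> 'u \<Rightarrow> 'u) category)
    (AbSR X :: (('u, 'x) group_object, 'u \<Rightarrow> 'u) category)"
  unfolding equivalent_categories_def
  using category_SRMod[OF X] category_AbSR[OF X] cat_functor_total[OF X] cat_functor_fiber[OF X]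
    natural_isomorphism_unit[OF X] natural_isomorphism_counit[OF X]
  by blast

end

text \<open>Cardinal arithmetic: an infinite set is equinumerous with its square, and equality of
  cardinals means that a bijection exists.\<close>

lemma bij_pairing: "\<exists>enc :: 'u::infinite \<times> 'u \<Rightarrow> 'u. bij enc"
  using card_of_Times_same_infinite[OF infinite_UNIV[where 'a = 'u]]
  by (simp add: card_of_ordIso[symmetric])

theorem theorem4p4:
  fixes X :: "'u::infinite symm_rack"
  assumes "symmetric_rack X"
  shows "equivalent_categories
    (SRMod X :: (('u, 'u) sr_module, 'u \<Rightarrow> 'u \<Rightarrow> 'u) category)
    (AbSR X :: (('u, 'u) group_object, 'u \<Rightarrow> 'u) category)"
proof -
  \<comment> \<open>Base points and group elements share one infinite type, so a single bijective
    code for pairs over it serves all total spaces.\<close>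
  obtain enc :: "'u \<times> 'u \<Rightarrow> 'u" where "bij enc"
    using bij_pairing by blast
  then interpret self_pairing enc
    by (simp add: self_pairing_def pairing_def)
  show ?thesis
    by (rule equivalent_SRMod_AbSR[OF assms])
qed

end
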